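(* Let $g:\mathbb{N}\to\mathbb{C}$ be a multiplicative function satisfying \[ \sum_{p\in\mathcal{P}}\sum_{e\ge1}\frac{|g(p^e)-g(p^{e-1})|}{p^{2e}}<\infty, \] and let $f(n_1,n_2)=g(\gcd(n_1,n_2))$. Then for every $(n_1,n_2)\in\mathbb{N}\times\mathbb{N}$ the Ramanujan-Fourier series of $f$ converges and \[ f(n_1,n_2)=\sum_{q_1,q_2=1}^\infty a_{q_1,q_2}\,c_{q_1}(n_1)\,c_{q_2}(n_2), \] where $a_{1,1}=M(f)$ and, for $q_1,q_2$ with $\mathrm{lcm}(q_1,q_2)>1$, \[ a_{q_1,q_2}=M(f)\prod_{p\mid\mathrm{lcm}(q_1,q_2)}\frac{\displaystyle\sum_{e=\max(\nu_p(q_1),\nu_p(q_2))}^\infty\frac{g(p^e)-g(p^{e-1})}{p^{2e}}}{\displaystyle 1+\sum_{e=1}^\infty\frac{g(p^e)-g(p^{e-1})}{p^{2e}}}. \]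
   Context: $\mathcal{P}$ is the set of primes. For positive integers $q,n$, the Ramanujan sum is $c_q(n)=\sum_{1\le a\le q,\ \gcd(a,q)=1}\exp(2\pi i a n/q)$. For a prime $p$ and positive integer $q$, $\nu_p(q)$ is the exponent of $p$ in $q$ ($0$ if $p\nmid q$); $\mathrm{lcm}(q_1,q_2)$ is the least common multiple. The mean value of $f$ is $M(f)=\lim_{x,y\to\infty}\frac{1}{xy}\sum_{n_1\le x,\ n_2\le y}f(n_1,n_2)$; under the hypothesis this limit is known to exist and equals $\prod_{p\in\mathcal{P}}\bigl(1+\sum_{e\ge1}(g(p^e)-g(p^{e-1}))/p^{2e}\bigr)$. The coefficients $a_{q_1,q_2}$ are given by $a_{q_1,q_2}=\sum_{m_1,m_2\ge1}(f*\mu)(m_1q_1,m_2q_2)/(m_1q_1m_2q_2)$, where $(f*\mu)(n_1,n_2)=\sum_{d_1\mid n_1,\ d_2\mid n_2}f(d_1,d_2)\mu(n_1/d_1)\mu(n_2/d_2)$ with $\mu$ the Möbius function.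
   Formalization: The quotient formula for a_{q1,q2} is stated when the denominators 1+Σ(g(p^e)-g(p^{e-1}))/p^{2e} at p | lcm(q1,q2) are nonzero (they can vanish, leaving it undefined); in all cases a_{q1,q2} is also given with these factors cancelled against the Euler product of M(f). *)

theory Defs
  imports "HOL-Analysis.Analysis" "HOL-Computational_Algebra.Squarefree"
begin

text \<open>
  Arithmetic functions are functions on \<open>nat\<close> of which only the values at positive
  arguments matter.
\<close>

definition multiplicative_fn :: "(nat \<Rightarrow> complex) \<Rightarrow> bool" where
  "multiplicative_fn g \<longleftrightarrow>
     g 1 = 1 \<and> (\<forall>m n. m > 0 \<longrightarrow> n > 0 \<longrightarrow> coprime m n \<longrightarrow> g (m * n) = g m * g n)"

definition moebius_mu :: "nat \<Rightarrow> complex" where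
  "moebius_mu n = (if squarefree n then (- 1) ^ card (prime_factors n) else 0)"

definition ramanujan_sum :: "nat \<Rightarrow> nat \<Rightarrow> complex" where
  "ramanujan_sum q n =
     (\<Sum>a | 1 \<le> a \<and> a \<le> q \<and> coprime a q. exp (2 * of_real pi * \<i> * of_nat a * of_nat n / of_nat q))"

definition dirichlet_mu :: "(nat \<Rightarrow> nat \<Rightarrow> complex) \<Rightarrow> nat \<Rightarrow> nat \<Rightarrow> complex" where
  "dirichlet_mu f n1 n2 =
     (\<Sum>d1 | d1 dvd n1. \<Sum>d2 | d2 dvd n2.
        f d1 d2 * moebius_mu (n1 div d1) * moebius_mu (n2 div d2))"

definition rf_term :: "(nat \<Rightarrow> nat \<Rightarrow> complex) \<Rightarrow> nat \<Rightarrow> nat \<Rightarrow> nat \<times> nat \<Rightarrow> complex" where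
  "rf_term f q1 q2 = (\<lambda>(m1, m2).
     dirichlet_mu f (m1 * q1) (m2 * q2) / of_nat (m1 * q1 * m2 * q2))"

text \<open>The Ramanujan--Fourier coefficients \<open>a\<^sub>q\<^sub>1\<^sub>,\<^sub>q\<^sub>2\<close>.\<close>

definition rf_coeff :: "(nat \<Rightarrow> nat \<Rightarrow> complex) \<Rightarrow> nat \<Rightarrow> nat \<Rightarrow> complex" where
  "rf_coeff f q1 q2 = (\<Sum>\<^sub>\<infinity>m \<in> {1..} \<times> {1..}. rf_term f q1 q2 m)"

definition partial_mean :: "(nat \<Rightarrow> nat \<Rightarrow> complex) \<Rightarrow> real \<times> real \<Rightarrow> complex" where
  "partial_mean f = (\<lambda>(x, y).
     (\<Sum>n1 | 1 \<le> n1 \<and> real n1 \<le> x. \<Sum>n2 | 1 \<le> n2 \<and> real n2 \<le> y. f n1 n2) / of_real (x * y))"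

definition mean_value :: "(nat \<Rightarrow> nat \<Rightarrow> complex) \<Rightarrow> complex" where
  "mean_value f = Lim (at_top \<times>\<^sub>F at_top) (partial_mean f)"

definition local_term :: "(nat \<Rightarrow> complex) \<Rightarrow> nat \<Rightarrow> nat \<Rightarrow> complex" where
  "local_term g p e = (g (p ^ e) - g (p ^ (e - 1))) / of_nat (p ^ (2 * e))"

definition local_tail :: "(nat \<Rightarrow> complex) \<Rightarrow> nat \<Rightarrow> nat \<Rightarrow> complex" where
  "local_tail g p k = (\<Sum>\<^sub>\<infinity>e \<in> {k..}. local_term g p e)"

definition euler_factor :: "(nat \<Rightarrow> complex) \<Rightarrow> nat \<Rightarrow> complex" where
  "euler_factor g p = 1 + local_tail g p 1"

end

theory Submission
  imports Defs "HOL-Number_Theory.Totient"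
begin

text \<open>
  Let \<open>h = g * \<mu>\<close>, so \<open>h (p ^ e) = g (p ^ e) - g (p ^ (e - 1))\<close>. For \<open>f n1 n2 = g (gcd n1 n2)\<close> the
  double convolution \<open>f * \<mu>\<close> lives on the diagonal, where it equals \<open>h\<close>; hence \<open>a\<^sub>q\<^sub>1\<^sub>,\<^sub>q\<^sub>2\<close> is the sum of
  \<open>h n / n\<^sup>2\<close> over the multiples \<open>n\<close> of \<open>lcm q1 q2\<close>, which factors as an Euler product. Dominated
  convergence identifies \<open>a\<^sub>1\<^sub>,\<^sub>1\<close> with the mean value. Since the sum of \<open>\<bar>c\<^sub>q m\<bar>\<close> over \<open>q dvd n\<close> is at most
  \<open>\<sigma> m * 2 ^ \<omega> n\<close>, the triple sum of \<open>h n / n\<^sup>2 * c\<^sub>q\<^sub>1 n1 * c\<^sub>q\<^sub>2 n2\<close> over \<open>q1, q2 dvd n\<close> is absolutely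
  convergent (the weight \<open>4 ^ \<omega> n\<close> only multiplies the local series by 4). Summing over \<open>q1, q2\<close> first,
  by \<open>\<Sum>q dvd n. c\<^sub>q m = n\<close> if \<open>n dvd m\<close> and \<open>0\<close> otherwise, leaves the sum of \<open>h\<close> over the divisors of
  \<open>gcd n1 n2\<close>; summing over \<open>n\<close> first gives the Ramanujan-Fourier series.
\<close>

subsection \<open>Multiplicative functions and finite Euler products\<close>

text \<open>Stated over semirings so that real-valued norms are covered along with complex
  functions.\<close>

definition mult_fn :: "(nat \<Rightarrow> 'a::comm_semiring_1) \<Rightarrow> bool" where
  "mult_fn H \<longleftrightarrow> H 1 = 1 \<and> (\<forall>m n. m > 0 \<longrightarrow> n > 0 \<longrightarrow> coprime m n \<longrightarrow> H (m * n) = H m * H n)"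

lemma mult_fn_1: "mult_fn H \<Longrightarrow> H (Suc 0) = 1"
  by (simp add: mult_fn_def)

lemma mult_fn_mult: "mult_fn H \<Longrightarrow> m > 0 \<Longrightarrow> n > 0 \<Longrightarrow> coprime m n \<Longrightarrow> H (m * n) = H m * H n"
  by (simp add: mult_fn_def)

lemma mult_fn_norm:
  fixes H :: "nat \<Rightarrow> 'a::real_normed_field"
  shows "mult_fn H \<Longrightarrow> mult_fn (\<lambda>n. norm (H n))"
  by (simp add: mult_fn_def norm_mult)

lemma mult_fn_times: "mult_fn F \<Longrightarrow> mult_fn G \<Longrightarrow> mult_fn (\<lambda>n. F n * G n)"
  by (auto simp: mult_fn_def algebra_simps)

lemma mult_fn_divides: "mult_fn H \<Longrightarrow> mult_fn (\<lambda>n. if n dvd N then H n else 0)"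
  by (auto simp: mult_fn_def intro: divides_mult dvd_mult_left dvd_mult_right)

section \<open>Finite Euler products over smooth numbers\<close>

lemma has_sum_product:
  fixes f g :: "_ \<Rightarrow> 'a::{real_normed_field,banach}"
  assumes "(\<lambda>x. norm (f x)) summable_on A" "(\<lambda>x. norm (g x)) summable_on B"
  shows "(\<lambda>z. norm (f (fst z) * g (snd z))) summable_on A \<times> B"
    and "((\<lambda>z. f (fst z) * g (snd z)) has_sum infsum f A * infsum g B) (A \<times> B)"
proof -
  let ?h = "\<lambda>z. f (fst z) * g (snd z)"
  show *: "(\<lambda>z. norm (?h z)) summable_on A \<times> B"
    unfolding Infinite_Sum.abs_summable_on_Sigma_iff using assms
    by (auto simp: norm_mult infsum_cmult_right' abs_mult intro!: summable_on_cmult_right summable_on_cmult_left)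
  have "(g has_sum infsum g B) B" "(f has_sum infsum f A) A"
    using assms[THEN abs_summable_summable] by simp_all
  then show "(?h has_sum infsum f A * infsum g B) (A \<times> B)"
    using abs_summable_summable[OF *]
    by (intro has_sum_SigmaI[where g = "\<lambda>x. f x * infsum g B"])
       (auto intro: has_sum_cmult_right has_sum_cmult_left)
qed

text \<open>With \<open>K = 0\<close> these are the \<open>S\<close>-smooth numbers; with
  \<open>K\<close> the valuations of some \<open>L\<close> whose primes lie in \<open>S\<close>,
  they are the smooth multiples of \<open>L\<close>. One Euler product thus serves both for full
  sums and for sums over multiples.\<close>

definition smooth_multiples :: "nat set \<Rightarrow> (nat \<Rightarrow> nat) \<Rightarrow> nat set" where
  "smooth_multiples S K = {n. n > 0 \<and> prime_factors n \<subseteq> S \<and> (\<forall>p\<in>S. K p \<le> multiplicity p n)}"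

lemma multiplicity_mult_prime_power:
  fixes p :: nat
  assumes "prime p" "n > 0" "\<not> p dvd n"
  shows "multiplicity p (p ^ e * n) = e"
proof -
  have "multiplicity p (p ^ e * n) = multiplicity p (p ^ e) + multiplicity p n"
    using assms by (intro prime_elem_multiplicity_mult_distrib) auto
  then show ?thesis using assms by (simp add: not_dvd_imp_multiplicity_0)
qed

text \<open>Splitting off the \<open>p\<close>-part of a number is unique and leaves the valuations
  at the other primes alone. This is the induction step of the Euler product.\<close>

lemma bij_betw_smooth_multiples_insert:
  assumes p: "prime p" "p \<notin> S" and S: "\<And>q. q \<in> S \<Longrightarrow> prime q"
  shows "bij_betw (\<lambda>z. p ^ fst z * snd z) ({K p..} \<times> smooth_multiples S K)
           (smooth_multiples (insert p S) K)"
proof (rule bij_betwI[where g = "\<lambda>n. (multiplicity p n, n div p ^ multiplicity p n)"])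
  have ndvd: "\<not> p dvd n" if "n \<in> smooth_multiples S K" for n
    using that p by (auto simp: smooth_multiples_def prime_factors_dvd)
  have mq: "multiplicity q (p ^ e * n) = multiplicity q n" if "q \<in> S" "n > 0" for q e n
    using that p S[of q] multiplicity_distinct_prime_power[of q p e]
    by (subst prime_elem_multiplicity_mult_distrib) auto
  show "(\<lambda>z. p ^ fst z * snd z) \<in> {K p..} \<times> smooth_multiples S K \<rightarrow> smooth_multiples (insert p S) K"
  proof
    fix z assume z: "z \<in> {K p..} \<times> smooth_multiples S K"
    obtain e n where [simp]: "z = (e, n)" by (cases z)
    have e: "e \<in> {K p..}" and n: "n \<in> smooth_multiples S K" using z by auto
    have n0: "n > 0" using n by (simp add: smooth_multiples_def)
    have "x = p" if "prime x" "x dvd p ^ e" for x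
      using that p(1) by (meson prime_dvd_power primes_dvd_imp_eq)
    then have "prime_factors (p ^ e * n) \<subseteq> insert p S"
      using n p n0 by (auto simp: smooth_multiples_def prime_factors_dvd prime_dvd_mult_iff)
    then show "p ^ fst z * snd z \<in> smooth_multiples (insert p S) K"
      using e n n0 mq multiplicity_mult_prime_power[OF p(1) n0 ndvd[OF n]] p
      by (auto simp: smooth_multiples_def prime_gt_0_nat)
  qed
  show "(\<lambda>n. (multiplicity p n, n div p ^ multiplicity p n)) \<in>
      smooth_multiples (insert p S) K \<rightarrow> {K p..} \<times> smooth_multiples S K"
  proof
    fix n assume n: "n \<in> smooth_multiples (insert p S) K"
    define m where "m = n div p ^ multiplicity p n"
    have nm: "n = p ^ multiplicity p n * m" unfolding m_def by (simp add: multiplicity_dvd)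
    have n0: "n > 0" using n by (simp add: smooth_multiples_def)
    then have m0: "m > 0" using nm by (metis mult_0_right neq0_conv)
    have "\<not> p dvd m" unfolding m_def using n0 p(1)
      by (metis multiplicity_decompose neq0_conv not_prime_unit)
    moreover have "prime_factors m \<subseteq> prime_factors n"
      using nm n0 by (metis dvd_prime_factors dvd_triv_right neq0_conv)
    ultimately have "prime_factors m \<subseteq> S"
      using n by (auto simp: smooth_multiples_def dest: in_prime_factors_imp_dvd)
    moreover have "multiplicity q n = multiplicity q m" if "q \<in> S" for q
      using mq[OF that m0] nm by metis
    ultimately show "(multiplicity p n, n div p ^ multiplicity p n) \<in> {K p..} \<times> smooth_multiples S K"
      using n m0 by (auto simp: smooth_multiples_def m_def[symmetric])
  qed
  show "(multiplicity p (p ^ fst z * snd z),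
      p ^ fst z * snd z div p ^ multiplicity p (p ^ fst z * snd z)) = z"
    if z: "z \<in> {K p..} \<times> smooth_multiples S K" for z
  proof -
    have "snd z > 0" "\<not> p dvd snd z" "p > 0"
      using ndvd z p(1) by (auto simp: smooth_multiples_def prime_gt_0_nat)
    then show ?thesis by (simp add: multiplicity_mult_prime_power[OF p(1)])
  qed
  show "p ^ fst (multiplicity p n, n div p ^ multiplicity p n) *
      snd (multiplicity p n, n div p ^ multiplicity p n) = n" for n
    unfolding fst_conv snd_conv by (rule dvd_mult_div_cancel[OF multiplicity_dvd])
qed

text \<open>Induction on \<open>S\<close>: a new prime contributes an independent exponent, and
  \<open>H\<close> separates its power from the coprime cofactor, so the sum becomes a product.
  Absolute summability is carried along because multiplying the series requires it.\<close>

lemma has_sum_smooth_multiples: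
  fixes H :: "nat \<Rightarrow> 'a::{real_normed_field,banach}"
  assumes H: "mult_fn H" and "finite S" and "\<And>p. p \<in> S \<Longrightarrow> prime p"
    and "\<And>p. p \<in> S \<Longrightarrow> (\<lambda>e. norm (H (p ^ e))) summable_on UNIV"
  shows "(\<lambda>n. norm (H n)) summable_on smooth_multiples S K \<and>
    (H has_sum (\<Prod>p\<in>S. \<Sum>\<^sub>\<infinity>e\<in>{K p..}. H (p ^ e))) (smooth_multiples S K)"
  using assms(2-4)
proof (induction S rule: finite_induct)
  case empty
  have "smooth_multiples {} K = {1}"
    by (auto simp: smooth_multiples_def prime_factorization_empty_iff)
  then show ?case using has_sum_finite[of "{1}" H] by (simp add: mult_fn_1[OF H])
next
  case (insert p S)
  have p: "prime p" and S: "\<And>q. q \<in> S \<Longrightarrow> prime q" using insert by auto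
  let ?B = "smooth_multiples S K" and ?t = "\<lambda>p. \<Sum>\<^sub>\<infinity>e\<in>{K p..}. H (p ^ e)"
  let ?m = "\<lambda>z. p ^ fst z * snd z"
  have bij: "bij_betw ?m ({K p..} \<times> ?B) (smooth_multiples (insert p S) K)"
    using bij_betw_smooth_multiples_insert p S insert by blast
  have IH: "(\<lambda>n. norm (H n)) summable_on ?B" "(H has_sum (\<Prod>p\<in>S. ?t p)) ?B"
    using insert by auto
  have sp: "(\<lambda>e. norm (H (p ^ e))) summable_on {K p..}"
    using insert.prems by (auto intro: summable_on_subset)
  have eq: "H (?m z) = H (p ^ fst z) * H (snd z)" if "z \<in> {K p..} \<times> ?B" for z
  proof -
    have "snd z > 0" "\<not> p dvd snd z"
      using that p \<open>p \<notin> S\<close> by (auto simp: smooth_multiples_def prime_factors_dvd)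
    then show ?thesis using p
      by (intro mult_fn_mult[OF H]) (auto simp: prime_gt_0_nat intro: prime_imp_coprime)
  qed
  have 1: "(\<lambda>z. norm (H (?m z))) summable_on {K p..} \<times> ?B"
    using has_sum_product(1)[OF sp IH(1)] by (rule summable_on_cong[THEN iffD2, rotated]) (simp only: eq)
  have 2: "((\<lambda>z. H (?m z)) has_sum ?t p * infsum H ?B) ({K p..} \<times> ?B)"
    using has_sum_product(2)[OF sp IH(1)] by (rule has_sum_cong[THEN iffD2, rotated]) (simp only: eq)
  show ?case
    using 1 2 infsumI[OF IH(2)] insert.hyps
    unfolding summable_on_reindex_bij_betw[OF bij, of "\<lambda>n. norm (H n)"]
      has_sum_reindex_bij_betw[OF bij, of H] by simp
qed

lemma divisor_sum_mult_fn:
  fixes H :: "nat \<Rightarrow> 'a::{real_normed_field,banach}"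
  assumes H: "mult_fn H" and N: "N > 0"
  shows "(\<Sum>d | d dvd N. H d) = (\<Prod>p\<in>prime_factors N. \<Sum>e\<le>multiplicity p N. H (p ^ e))"
proof -
  \<comment> \<open>\<open>H\<close> cut off at the divisors of \<open>N\<close> is again multiplicative, so its Euler product applies.\<close>
  define G where "G = (\<lambda>n. if n dvd N then H n else 0)"
  let ?P = "prime_factors N" and ?B = "smooth_multiples (prime_factors N) (\<lambda>_. 0)"
  have G: "mult_fn G" unfolding G_def using H by (rule mult_fn_divides)
  have Gp: "G (p ^ e) = (if e \<le> multiplicity p N then H (p ^ e) else 0)" if "p \<in> ?P" for p e
  proof -
    have "prime p" using that by auto
    then have "p ^ e dvd N \<longleftrightarrow> e \<le> multiplicity p N"
      using N by (intro power_dvd_iff_le_multiplicity) auto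
    then show ?thesis by (simp add: G_def)
  qed
  have *: "((\<lambda>e. G (p ^ e)) has_sum (\<Sum>e\<le>multiplicity p N. H (p ^ e))) UNIV" if "p \<in> ?P" for p
    using Gp[OF that] by (intro has_sum_finite_neutralI[of "{..multiplicity p N}"]) auto
  have "(\<lambda>e. norm (G (p ^ e))) summable_on UNIV" if "p \<in> ?P" for p
    by (rule finite_nonzero_values_imp_summable_on, rule finite_subset[of _ "{..multiplicity p N}"])
       (auto simp: Gp[OF that])
  then have "(G has_sum (\<Prod>p\<in>?P. \<Sum>\<^sub>\<infinity>e\<in>{0..}. G (p ^ e))) ?B"
    using has_sum_smooth_multiples[OF G, of ?P "\<lambda>_. 0"] by auto
  also have "(\<Prod>p\<in>?P. \<Sum>\<^sub>\<infinity>e\<in>{0..}. G (p ^ e)) = (\<Prod>p\<in>?P. \<Sum>e\<le>multiplicity p N. H (p ^ e))"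
    using infsumI[OF *] by (intro prod.cong) auto
  finally have 1: "(G has_sum (\<Prod>p\<in>?P. \<Sum>e\<le>multiplicity p N. H (p ^ e))) ?B" .
  \<comment> \<open>All divisors of \<open>N\<close> lie in \<open>?B\<close> and \<open>G\<close>
    vanishes elsewhere, so the same sum is evaluated a second way.\<close>
  have "(G has_sum (\<Sum>d | d dvd N. H d)) ?B"
  proof (rule has_sum_finite_neutralI[of "{d. d dvd N}"])
    show "{d. d dvd N} \<subseteq> ?B"
      using N by (auto simp: smooth_multiples_def prime_factors_dvd dvd_pos_nat intro: dvd_trans)
  qed (use N in \<open>auto simp: G_def\<close>)
  from has_sum_unique[OF this 1] show ?thesis .
qed

subsection \<open>The Moebius function and Ramanujan sums\<close>

lemma mult_fn_moebius_mu: "mult_fn moebius_mu"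
  unfolding mult_fn_def
proof (intro conjI allI impI)
  fix m n :: nat
  assume mn: "m > 0" "n > 0" "coprime m n"
  have "prime_factors m \<inter> prime_factors n = {}"
    using mn by (auto simp: prime_factors_dvd dest: coprime_common_divisor)
  then have "card (prime_factors (m * n)) = card (prime_factors m) + card (prime_factors n)"
    using mn by (simp add: prime_factors_product card_Un_disjoint)
  moreover have "squarefree (m * n) \<longleftrightarrow> squarefree m \<and> squarefree n"
    using mn squarefree_mult_coprime squarefree_multD by blast
  ultimately show "moebius_mu (m * n) = moebius_mu m * moebius_mu n"
    by (simp add: moebius_mu_def power_add)
qed (simp add: moebius_mu_def)

lemma moebius_mu_prime_power:
  assumes "prime p"
  shows "moebius_mu (p ^ e) = (if e = 0 then 1 else if e = 1 then -1 else 0)"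
proof -
  have "\<not> is_unit p" using assms not_prime_unit by blast
  then show ?thesis using assms squarefree_prime[OF assms]
    by (auto simp: moebius_mu_def squarefree_power_iff prime_factorization_prime simp del: nat_dvd_1_iff_1)
qed

text \<open>Only the exponents 0 and 1 contribute, and both occur because \<open>p\<close> divides
  \<open>N\<close>. The map \<open>c\<close> lets one computation serve for
  \<open>moebius_mu\<close> and for its norm.\<close>

lemma sum_atMost_moebius_prime_power:
  fixes c :: "complex \<Rightarrow> 'a::comm_monoid_add"
  assumes "p \<in> prime_factors N" "c 0 = 0"
  shows "(\<Sum>e\<le>multiplicity p N. c (moebius_mu (p ^ e))) = c 1 + c (-1)"
proof -
  have "(\<Sum>e\<le>multiplicity p N. c (moebius_mu (p ^ e))) = (\<Sum>e\<in>{0,1}. c (moebius_mu (p ^ e)))"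
    using assms by (intro sum.mono_neutral_right)
      (auto simp: moebius_mu_prime_power prime_factors_multiplicity)
  moreover have "prime p" using assms by auto
  ultimately show ?thesis
    using moebius_mu_prime_power[of p 0] moebius_mu_prime_power[of p 1] by simp
qed

text \<open>Every local factor is 1 + (-1) = 0, so the product survives only when it is empty, that
  is for \<open>N = 1\<close>.\<close>

lemma sum_moebius_mu:
  assumes "N > 0"
  shows "(\<Sum>d | d dvd N. moebius_mu d) = (if N = 1 then 1 else 0)"
proof -
  have "(\<Sum>d | d dvd N. moebius_mu d) = (\<Prod>p\<in>prime_factors N. 0)"
    unfolding divisor_sum_mult_fn[OF mult_fn_moebius_mu assms]
    using sum_atMost_moebius_prime_power[where c = "\<lambda>x. x"] by (intro prod.cong) auto
  then show ?thesis using assms by (auto simp: prime_factorization_empty_iff card_gt_0_iff)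
qed

text \<open>Every local factor is now 1 + 1; the sum counts the squarefree divisors.\<close>

lemma sum_norm_moebius_mu:
  assumes "N > 0"
  shows "(\<Sum>d | d dvd N. norm (moebius_mu d)) = 2 ^ card (prime_factors N)"
proof -
  have "(\<Sum>d | d dvd N. norm (moebius_mu d)) = (\<Prod>p\<in>prime_factors N. 2)"
    unfolding divisor_sum_mult_fn[OF mult_fn_norm[OF mult_fn_moebius_mu] assms]
    using sum_atMost_moebius_prime_power[where c = norm] by (intro prod.cong) auto
  then show ?thesis by simp
qed

lemma sum_divisor_multiples:
  fixes F :: "nat \<Rightarrow> 'a::comm_monoid_add"
  assumes "n > 0" "d dvd n"
  shows "(\<Sum>k | k dvd n \<and> d dvd k. F (n div k)) = (\<Sum>j | j dvd n div d. F j)"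
proof (rule sum.reindex_bij_witness[of _ "\<lambda>j. n div j" "\<lambda>k. n div k"])
  have d0: "d > 0" using assms dvd_pos_nat by blast
  fix j assume "j \<in> {j. j dvd n div d}"
  then obtain l where l: "n div d = j * l" by (auto elim: dvdE)
  with assms have n: "n = d * j * l" by (metis dvd_mult_div_cancel mult.assoc)
  show "n div j \<in> {k. k dvd n \<and> d dvd k}" "n div (n div j) = j"
    using n assms d0 by (auto simp: ac_simps)
next
  fix k assume k: "k \<in> {k. k dvd n \<and> d dvd k}"
  have d0: "d > 0" using assms dvd_pos_nat by blast
  from k obtain a b where n: "n = d * a * b" "k = d * a" by (auto elim!: dvdE)
  show "n div (n div k) = k" "n div k \<in> {j. j dvd n div d}" "F (n div k) = F (n div k)"
    using n assms d0 by (auto simp: ac_simps)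
qed

text \<open>Passing to complementary divisors turns this into the divisor sum of
  \<open>moebius_mu\<close> at \<open>n div d\<close>, which is 1 exactly for \<open>d = n\<close>;
  when \<open>d\<close> does not divide \<open>n\<close> the sum is empty.\<close>

lemma sum_moebius_mu_multiples:
  assumes "n > 0"
  shows "(\<Sum>k | k dvd n \<and> d dvd k. moebius_mu (n div k)) = (if d = n then 1 else 0)"
proof (cases "d dvd n")
  case True
  then have "n div d > 0" "n div d = 1 \<longleftrightarrow> d = n"
    using assms by (auto elim!: dvdE)
  then show ?thesis
    using sum_divisor_multiples[OF assms True, of moebius_mu] sum_moebius_mu[of "n div d"] by simp
next
  case False
  then have "{k. k dvd n \<and> d dvd k} = {}" by (auto dest: dvd_trans)
  with False show ?thesis by (metis (no_types, lifting) dvd_refl sum.empty)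
qed

text \<open>Expanding \<open>F\<close> and exchanging the sums leaves, for each \<open>k\<close>,
  the sum of \<open>moebius_mu (n div d)\<close> over the multiples \<open>d\<close> of
  \<open>k\<close> that divide \<open>n\<close>; only \<open>k = n\<close> survives.\<close>

lemma moebius_inversion:
  assumes "n > 0" and "\<And>m. m > 0 \<Longrightarrow> F m = (\<Sum>d | d dvd m. G d)"
  shows "(\<Sum>d | d dvd n. F d * moebius_mu (n div d)) = G n"
proof -
  have fin: "finite {d. d dvd n}" using assms by simp
  have "(\<Sum>d | d dvd n. F d * moebius_mu (n div d))
      = (\<Sum>d | d dvd n. \<Sum>k | k dvd n. if k dvd d then G k * moebius_mu (n div d) else 0)"
  proof (rule sum.cong[OF refl])
    fix d assume d: "d \<in> {d. d dvd n}"
    then have "F d = (\<Sum>k | k dvd n \<and> k dvd d. G k)"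
      using assms dvd_pos_nat by (subst assms(2)) (auto intro!: sum.cong dest: dvd_trans)
    then show "F d * moebius_mu (n div d) = (\<Sum>k | k dvd n. if k dvd d then G k * moebius_mu (n div d) else 0)"
      using fin by (simp add: sum_distrib_right flip: sum.inter_filter)
  qed
  also have "\<dots> = (\<Sum>k | k dvd n. \<Sum>d | d dvd n. if k dvd d then G k * moebius_mu (n div d) else 0)"
    by (rule sum.swap)
  also have "\<dots> = (\<Sum>k | k dvd n. G k * (if k = n then 1 else 0))"
    using fin by (intro sum.cong refl)
      (simp add: sum_moebius_mu_multiples[OF assms(1), symmetric] sum_distrib_left flip: sum.inter_filter)
  also have "\<dots> = G n" using fin by (simp add: if_distrib cong: if_cong)
  finally show ?thesis .
qed

section \<open>Ramanujan sums\<close>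

lemma sum_exp_multiples:
  assumes "n > 0"
  shows "(\<Sum>a\<in>{0<..n}. exp (2 * of_real pi * \<i> * of_nat a * of_nat m / of_nat n))
       = (if n dvd m then of_nat n else 0 :: complex)"
proof -
  \<comment> \<open>The terms are the powers of an \<open>n\<close>-th root of unity
    \<open>w\<close>: their geometric sum vanishes unless \<open>w = 1\<close>, which happens
    exactly when \<open>n\<close> divides \<open>m\<close>.\<close>
  define w :: complex where "w = exp (2 * of_real pi * \<i> * of_nat m / of_nat n)"
  have w: "exp (2 * of_real pi * \<i> * of_nat a * of_nat m / of_nat n) = w ^ a" for a
    unfolding w_def by (subst exp_of_nat_mult[symmetric]) (simp add: field_simps)
  have wn: "w ^ n = 1"
    unfolding w[symmetric] using assms exp_integer_2pi[of "of_nat m"] by (simp add: ac_simps)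
  have "(\<Sum>a\<in>{0<..n}. w ^ a) = (\<Sum>a<n. w ^ Suc a)"
    by (rule sum.reindex_bij_witness[of _ Suc "\<lambda>a. a - 1"]) auto
  also have "\<dots> = w * (\<Sum>a<n. w ^ a)" by (simp add: sum_distrib_left)
  also have "\<dots> = (if w = 1 then of_nat n else 0)"
    using wn by (simp add: geometric_sum)
  also have "w = 1 \<longleftrightarrow> n dvd m"
  proof -
    have "w = 1 \<longleftrightarrow> (\<exists>k::int. real m / real n = of_int k)"
    proof -
      have "2 * pi * real m / real n = of_int (2 * k) * pi \<longleftrightarrow> real m / real n = of_int k" for k :: int
      proof -
        have "2 * pi * real m / real n = 2 * pi * (real m / real n)"
          "of_int (2 * k) * pi = 2 * pi * of_int k" by simp_all
        then show ?thesis by (simp only: mult_cancel_left) simp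
      qed
      then show ?thesis unfolding w_def exp_eq_1 by (simp add: mult.assoc)
    qed
    also have "\<dots> \<longleftrightarrow> (\<exists>k::int. int m = k * int n)"
    proof (intro ex_cong1)
      fix k :: int
      have "real m / real n = of_int k \<longleftrightarrow> real_of_int (int m) = real_of_int (k * int n)"
        using assms by (simp add: field_simps)
      then show "real m / real n = of_int k \<longleftrightarrow> int m = k * int n"
        using of_int_eq_iff by metis
    qed
    also have "\<dots> \<longleftrightarrow> n dvd m"
      by (metis dvd_def int_dvd_int_iff mult.commute)
    finally show ?thesis .
  qed
  finally show ?thesis by (simp add: w)
qed

text \<open>The fractions k/n with 0 < k \<le> n, reduced to lowest terms, have the divisors
  \<open>q\<close> of \<open>n\<close> as denominators, each with every numerator coprime to
  \<open>q\<close> once. So the Ramanujan sums add up to the full exponential sum over k.\<close>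

lemma sum_ramanujan_sum_divisors:
  assumes "n > 0"
  shows "(\<Sum>q | q dvd n. ramanujan_sum q m) = (if n dvd m then of_nat n else 0)"
proof -
  define E :: "nat \<Rightarrow> nat \<Rightarrow> complex"
    where "E = (\<lambda>q a. exp (2 * of_real pi * \<i> * of_nat a * of_nat m / of_nat q))"
  define A where "A = (\<lambda>d. {k\<in>{0<..n}. gcd k n = d})"
  \<comment> \<open>Here \<open>d\<close> is the gcd of the numerator with \<open>n\<close>, so that
    \<open>n div d\<close> is the reduced denominator.\<close>
  have *: "ramanujan_sum (n div d) m = (\<Sum>k\<in>A d. E n k)" if d: "d dvd n" for d
  proof -
    have d0: "d > 0" using d assms dvd_pos_nat by blast
    have "ramanujan_sum (n div d) m = (\<Sum>a\<in>totatives (n div d). E (n div d) a)"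
      by (auto simp: ramanujan_sum_def E_def totatives_def Suc_le_eq intro!: sum.cong)
    also have "\<dots> = (\<Sum>a\<in>totatives (n div d). E n (a * d))"
      using d d0 assms by (auto simp: E_def ac_simps elim!: dvdE intro!: sum.cong)
    also have "\<dots> = (\<Sum>k\<in>A d. E n k)"
      using bij_betw_totatives_gcd_eq[OF d assms] unfolding A_def
      by (rule sum.reindex_bij_betw)
    finally show ?thesis .
  qed
  have "(\<Sum>q | q dvd n. ramanujan_sum q m) = (\<Sum>d | d dvd n. ramanujan_sum (n div d) m)"
    using assms by (intro sum.reindex_bij_witness[of _ "(div) n" "(div) n"]) (auto elim: dvdE)
  also have "\<dots> = (\<Sum>d | d dvd n. \<Sum>k\<in>A d. E n k)" using * by simp
  also have "\<dots> = (\<Sum>k\<in>(\<Union>d\<in>{d. d dvd n}. A d). E n k)"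
    using assms by (intro sum.UNION_disjoint[symmetric]) (auto simp: A_def)
  also have "(\<Union>d\<in>{d. d dvd n}. A d) = {0<..n}" by (auto simp: A_def)
  finally show ?thesis using sum_exp_multiples[OF assms, of m] by (simp add: E_def)
qed

text \<open>Moebius inversion writes \<open>ramanujan_sum q m\<close> as the sum of
  \<open>d * moebius_mu (q div d)\<close> over the common divisors \<open>d\<close> of
  \<open>q\<close> and \<open>m\<close>. After the triangle inequality and an exchange of sums, the
  quotients \<open>q div d\<close> contribute the power of 2 and the \<open>d\<close> contribute the
  divisor sum of \<open>m\<close>.\<close>

lemma sum_norm_ramanujan_sum_divisors:
  assumes n: "n > 0" and m: "m > 0"
  shows "(\<Sum>q | q dvd n. norm (ramanujan_sum q m))
       \<le> (\<Sum>d | d dvd m. real d) * 2 ^ card (prime_factors n)"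
proof -
  define D where "D = (\<lambda>d. if d dvd m then real d else 0)"
  have D0: "D d \<ge> 0" for d by (simp add: D_def)
  have fin: "finite {d. d dvd n}" using n by simp
  have "(\<Sum>q | q dvd n. norm (ramanujan_sum q m))
      \<le> (\<Sum>q | q dvd n. \<Sum>d | d dvd n. if d dvd q then D d * norm (moebius_mu (q div d)) else 0)"
  proof (rule sum_mono)
    fix q assume q: "q \<in> {q. q dvd n}"
    then have q0: "q > 0" using n dvd_pos_nat by blast
    have "ramanujan_sum q m = (\<Sum>d | d dvd q. (if d dvd m then of_nat d else 0) * moebius_mu (q div d))"
      by (rule moebius_inversion[symmetric, OF q0]) (simp add: sum_ramanujan_sum_divisors)
    also have "norm \<dots> \<le> (\<Sum>d | d dvd q. D d * norm (moebius_mu (q div d)))"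
      by (rule order_trans[OF norm_sum]) (auto simp: D_def norm_mult intro!: sum_mono)
    also have "\<dots> = (\<Sum>d | d dvd n \<and> d dvd q. D d * norm (moebius_mu (q div d)))"
      using q by (intro sum.cong) (auto dest: dvd_trans)
    also have "\<dots> = (\<Sum>d | d dvd n. if d dvd q then D d * norm (moebius_mu (q div d)) else 0)"
      using fin by (simp flip: sum.inter_filter)
    finally show "norm (ramanujan_sum q m) \<le> \<dots>" .
  qed
  also have "\<dots> = (\<Sum>d | d dvd n. \<Sum>q | q dvd n. if d dvd q then D d * norm (moebius_mu (q div d)) else 0)"
    by (rule sum.swap)
  also have "\<dots> \<le> (\<Sum>d | d dvd n. D d * 2 ^ card (prime_factors n))"
  proof (rule sum_mono)
    fix d assume d: "d \<in> {d. d dvd n}"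
    then have d0: "d > 0" using n dvd_pos_nat by blast
    \<comment> \<open>For fixed \<open>d\<close> the quotients \<open>q div d\<close> are distinct
      divisors of \<open>n\<close>.\<close>
    have "(\<Sum>q | q dvd n \<and> d dvd q. norm (moebius_mu (q div d)))
        = (\<Sum>j\<in>(\<lambda>q. q div d) ` {q. q dvd n \<and> d dvd q}. norm (moebius_mu j))"
      using d0 by (subst sum.reindex) (auto simp: inj_on_def elim!: dvdE)
    also have "\<dots> \<le> (\<Sum>j | j dvd n. norm (moebius_mu j))"
      using fin d0 by (intro sum_mono2) (auto elim!: dvdE)
    also have "\<dots> = 2 ^ card (prime_factors n)" by (rule sum_norm_moebius_mu[OF n])
    finally have "(\<Sum>q | q dvd n \<and> d dvd q. norm (moebius_mu (q div d))) \<le> 2 ^ card (prime_factors n)" .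
    from mult_left_mono[OF this D0[of d]]
    show "(\<Sum>q | q dvd n. if d dvd q then D d * norm (moebius_mu (q div d)) else 0)
        \<le> D d * 2 ^ card (prime_factors n)"
      using fin by (simp add: sum_distrib_left flip: sum.inter_filter)
  qed
  also have "\<dots> = (\<Sum>d | d dvd n. D d) * 2 ^ card (prime_factors n)"
    by (simp add: sum_distrib_right)
  also have "(\<Sum>d | d dvd n. D d) = (\<Sum>d | d dvd n \<and> d dvd m. real d)"
    using fin by (simp add: D_def flip: sum.inter_filter)
  also have "\<dots> \<le> (\<Sum>d | d dvd m. real d)"
    using m by (intro sum_mono2) auto
  finally show ?thesis by simp
qed

subsection \<open>Euler products with finitely many prescribed valuations\<close>

lemma norm_infsum_diff_le:
  fixes G :: "'a \<Rightarrow> 'b::banach"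
  assumes M: "M summable_on A" and G: "\<And>n. n \<in> A \<Longrightarrow> norm (G n) \<le> M n"
    and X: "finite X" "X \<subseteq> A"
  shows "norm (infsum G A - sum G X) \<le> infsum M A - sum M X"
proof (rule norm_infsum_le)
  have "(\<lambda>n. norm (G n)) summable_on A"
    using M G by (rule Infinite_Sum.abs_summable_on_comparison_test')
  then have "(G has_sum infsum G A) A"
    using abs_summable_summable has_sum_infsum by blast
  \<comment> \<open>The error is itself a sum of \<open>G\<close>, over \<open>A - X\<close>, where
    the tail of \<open>M\<close> dominates it.\<close>
  then show "(G has_sum infsum G A - sum G X) (A - X)"
    using X by (intro has_sum_Diff has_sum_finite)
  show "(M has_sum infsum M A - sum M X) (A - X)"
    using X M by (intro has_sum_Diff has_sum_finite has_sum_infsum)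
qed (use G in auto)

text \<open>A finite set \<open>X\<close> carries all but a small part of the sum of
  \<open>M\<close>, and on it the limit passes termwise. The arbitrary filter serves the growing
  prime bound as well as the double limit of the mean.\<close>

lemma tendsto_infsum_dominated:
  fixes F :: "'b \<Rightarrow> 'a \<Rightarrow> 'c::banach"
  assumes M: "M summable_on A"
    and F: "eventually (\<lambda>i. \<forall>n\<in>A. norm (F i n) \<le> M n) \<F>"
    and L: "\<And>n. n \<in> A \<Longrightarrow> norm (L n) \<le> M n"
    and lim: "\<And>n. n \<in> A \<Longrightarrow> ((\<lambda>i. F i n) \<longlongrightarrow> L n) \<F>"
  shows "((\<lambda>i. infsum (F i) A) \<longlongrightarrow> infsum L A) \<F>"
proof (rule tendstoI)
  fix \<epsilon> :: real assume \<epsilon>: "\<epsilon> > 0"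
  obtain X where X: "finite X" "X \<subseteq> A" and "dist (sum M X) (infsum M A) \<le> \<epsilon> / 4"
    using has_sum_finite_approximation[OF has_sum_infsum[OF M], of "\<epsilon> / 4"] \<epsilon> by auto
  then have tail: "infsum M A - sum M X \<le> \<epsilon> / 4" unfolding dist_real_def by linarith
  have "((\<lambda>i. sum (F i) X) \<longlongrightarrow> sum L X) \<F>"
    using lim X by (intro tendsto_sum) auto
  then have "eventually (\<lambda>i. dist (sum (F i) X) (sum L X) < \<epsilon> / 4) \<F>"
    using \<epsilon> by (intro tendstoD) auto
  then show "eventually (\<lambda>i. dist (infsum (F i) A) (infsum L A) < \<epsilon>) \<F>"
    using F
  proof eventually_elim
    case (elim i)
    \<comment> \<open>Two tails and one finite part, each at most \<open>\<epsilon> / 4\<close>,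
      stay below \<open>\<epsilon>\<close>.\<close>
    have "norm (infsum (F i) A - sum (F i) X) \<le> \<epsilon> / 4" "norm (infsum L A - sum L X) \<le> \<epsilon> / 4"
      using norm_infsum_diff_le[OF M _ X, of "F i"] norm_infsum_diff_le[OF M L X] elim(2) tail
      by force+
    then have "dist (infsum (F i) A) (sum (F i) X) \<le> \<epsilon> / 4" "dist (infsum L A) (sum L X) \<le> \<epsilon> / 4"
      by (simp_all add: dist_norm)
    moreover have "dist (infsum (F i) A) (infsum L A)
        \<le> dist (infsum (F i) A) (sum (F i) X) + dist (sum (F i) X) (sum L X) + dist (infsum L A) (sum L X)"
      by metric
    ultimately show ?case using elim(1) \<epsilon> by linarith
  qed
qed

section \<open>Absolutely convergent Euler products\<close>

definition prime_power_summable :: "(nat \<Rightarrow> 'a::real_normed_vector) \<Rightarrow> bool" where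
  "prime_power_summable H \<longleftrightarrow> (\<lambda>(p, e). norm (H (p ^ e))) summable_on ({p. prime p} \<times> {1..})"

lemma prime_power_summable_fiber:
  assumes "prime_power_summable H" "prime p"
  shows "(\<lambda>e. norm (H (p ^ e))) summable_on {k..}"
proof -
  have "(\<lambda>e. norm (H (p ^ e))) summable_on {1..}"
    using assms unfolding prime_power_summable_def
    by (intro summable_on_SigmaD1[where f = "\<lambda>p e. norm (H (p ^ e))"]) auto
  \<comment> \<open>For a single prime, exponent 0 adds just one term. Over all primes at once it
    would repeat the norm of \<open>H 1\<close> infinitely often, hence the lower bound 1 in
    \<open>prime_power_summable\<close>.\<close>
  then have "(\<lambda>e. norm (H (p ^ e))) summable_on insert 0 {1..}"
    by (simp add: summable_on_insert_iff)
  then show ?thesis by (rule summable_on_subset) auto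
qed

lemma prime_power_summable_primes:
  assumes "prime_power_summable H"
  shows "(\<lambda>p. \<Sum>\<^sub>\<infinity>e\<in>{1..}. norm (H (p ^ e))) summable_on {p. prime p}"
  using summable_on_Sigma_banach[of "\<lambda>p e. norm (H (p ^ e))" "{p. prime p}" "\<lambda>_. {1..}"] assms
  unfolding prime_power_summable_def by simp

lemma infsum_powers_from_0:
  fixes H :: "nat \<Rightarrow> 'a::banach"
  assumes "(\<lambda>e. norm (H (p ^ e))) summable_on {1..}"
  shows "(\<Sum>\<^sub>\<infinity>e\<in>{0..}. H (p ^ e)) = H 1 + (\<Sum>\<^sub>\<infinity>e\<in>{1..}. H (p ^ e))"
proof -
  have "{0..} = insert 0 {1::nat..}" by auto
  then show ?thesis
    using infsum_insert[OF abs_summable_summable[OF assms], of 0] by simp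
qed

text \<open>Any finite partial sum runs over numbers smooth for a finite set of primes, so a finite
  Euler product of norms bounds it. By \<open>1 + T p \<le> exp (T p)\<close> this is at most the
  exponential of the sum of \<open>T\<close> over all primes, a bound independent of the partial
  sum.\<close>

lemma abs_summable_mult_fn:
  fixes H :: "nat \<Rightarrow> 'a::{real_normed_field,banach}"
  assumes H: "mult_fn H" and summ: "prime_power_summable H"
  shows "(\<lambda>n. norm (H n)) summable_on {1..}"
proof (rule nonneg_bdd_above_summable_on)
  define T where "T = (\<lambda>p. \<Sum>\<^sub>\<infinity>e\<in>{1..}. norm (H (p ^ e)))"
  have T: "T summable_on {p. prime p}" "T p \<ge> 0" for p
    unfolding T_def using prime_power_summable_primes[OF summ] by (auto intro: infsum_nonneg)
  show "bdd_above (sum (\<lambda>n. norm (H n)) ` {F. F \<subseteq> {1..} \<and> finite F})"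
  proof (rule bdd_aboveI2)
    fix F assume F: "F \<in> {F. F \<subseteq> {1::nat..} \<and> finite F}"
    define S where "S = (\<Union>n\<in>F. prime_factors n)"
    have S: "finite S" "\<And>p. p \<in> S \<Longrightarrow> prime p" using F by (auto simp: S_def)
    let ?B = "smooth_multiples S (\<lambda>_. 0)"
    have "F \<subseteq> ?B" using F by (auto simp: smooth_multiples_def S_def)
    have fib: "(\<lambda>e. norm (norm (H (p ^ e)))) summable_on {k..}" if "p \<in> S" for p k
      using prime_power_summable_fiber[OF summ S(2)[OF that]] by simp
    have B: "((\<lambda>n. norm (H n)) has_sum (\<Prod>p\<in>S. \<Sum>\<^sub>\<infinity>e\<in>{0..}. norm (H (p ^ e)))) ?B"
      using has_sum_smooth_multiples[OF mult_fn_norm[OF H] S, of "\<lambda>_. 0"] fib[of _ 0] by simp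
    have "(\<Sum>n\<in>F. norm (H n)) \<le> (\<Prod>p\<in>S. \<Sum>\<^sub>\<infinity>e\<in>{0..}. norm (H (p ^ e)))"
      using B F \<open>F \<subseteq> ?B\<close> by (intro finite_sum_le_has_sum[OF B]) auto
    also have "\<dots> = (\<Prod>p\<in>S. 1 + T p)"
      using infsum_powers_from_0[OF fib] mult_fn_1[OF H]
      by (intro prod.cong) (auto simp: T_def)
    also have "\<dots> \<le> (\<Prod>p\<in>S. exp (T p))"
      using T(2) by (intro prod_mono) (auto intro: add_nonneg_nonneg)
    also have "\<dots> = exp (sum T S)" using S by (simp add: exp_sum)
    also have "sum T S \<le> infsum T {p. prime p}"
      using S T by (intro finite_sum_le_infsum) auto
    finally show "(\<Sum>n\<in>F. norm (H n)) \<le> exp (infsum T {p. prime p})" by simp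
  qed
qed simp

text \<open>The finite Euler products over primes up to \<open>N\<close> converge to both sides as
  \<open>N\<close> grows. Keeping the primes of \<open>L\<close> apart from the infinite product
  avoids dividing by Euler factors, which may vanish.\<close>

lemma euler_product:
  fixes H :: "nat \<Rightarrow> complex"
  assumes H: "mult_fn H" and summ: "prime_power_summable H" and L: "L > 0"
    and K: "\<And>p. prime p \<Longrightarrow> \<not> p dvd L \<Longrightarrow> K p = 0"
  shows "infsum H {n. n > 0 \<and> (\<forall>p\<in>prime_factors L. K p \<le> multiplicity p n)}
    = (\<Prod>p\<in>prime_factors L. \<Sum>\<^sub>\<infinity>e\<in>{K p..}. H (p ^ e)) *
      (\<Prod>p. if prime p \<and> \<not> p dvd L then 1 + (\<Sum>\<^sub>\<infinity>e\<in>{1..}. H (p ^ e)) else 1)"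
proof -
  define A where "A = {n. n > 0 \<and> (\<forall>p\<in>prime_factors L. K p \<le> multiplicity p n)}"
  define S where "S = (\<lambda>N::nat. {p. prime p \<and> p \<le> N})"
  define t where "t = (\<lambda>p. \<Sum>\<^sub>\<infinity>e\<in>{K p..}. H (p ^ e))"
  define E where "E = (\<lambda>p. if prime p \<and> \<not> p dvd L then 1 + (\<Sum>\<^sub>\<infinity>e\<in>{1..}. H (p ^ e)) else 1)"
  have S: "finite (S N)" "\<And>p. p \<in> S N \<Longrightarrow> prime p" for N
    unfolding S_def by (rule finite_subset[of _ "{..N}"]) auto
  let ?B = "\<lambda>N. smooth_multiples (S N) K"
  have fib: "(\<lambda>e. norm (H (p ^ e))) summable_on {k..}" if "prime p" for p k
    using prime_power_summable_fiber[OF summ that] .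
  have "(\<lambda>N. infsum (\<lambda>n. if n \<in> ?B N then H n else 0) A) \<longlonglongrightarrow> infsum H A"
  proof (rule tendsto_infsum_dominated)
    show "(\<lambda>n. norm (H n)) summable_on A"
      using abs_summable_mult_fn[OF H summ] by (rule summable_on_subset) (auto simp: A_def)
    fix n assume n: "n \<in> A"
    \<comment> \<open>From here on every prime factor of \<open>n\<close> is at most
      \<open>N\<close>; at primes outside \<open>L\<close> the bound \<open>K p\<close> is 0, so
      \<open>n\<close> lies in \<open>?B N\<close>.\<close>
    have "eventually (\<lambda>N. N \<ge> n + L) sequentially" by (rule eventually_ge_at_top)
    then have "eventually (\<lambda>N. (if n \<in> ?B N then H n else 0) = H n) sequentially"
    proof eventually_elim
      case (elim N)
      have "prime_factors n \<subseteq> S N"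
        using n elim by (auto simp: S_def prime_factors_dvd A_def dest!: dvd_imp_le)
      moreover have "K p \<le> multiplicity p n" if "p \<in> S N" for p
        using that n K[of p] L by (cases "p dvd L") (auto simp: S_def A_def prime_factors_dvd)
      ultimately show ?case using n by (auto simp: smooth_multiples_def A_def)
    qed
    then show "(\<lambda>N. if n \<in> ?B N then H n else 0) \<longlonglongrightarrow> H n"
      by (rule tendsto_eventually)
  qed auto
  moreover have "eventually (\<lambda>N. infsum (\<lambda>n. if n \<in> ?B N then H n else 0) A
      = (\<Prod>p\<in>prime_factors L. t p) * (\<Prod>p\<le>N. E p)) sequentially"
    using eventually_ge_at_top[of L]
  proof eventually_elim
    case (elim N)
    \<comment> \<open>From \<open>N \<ge> L\<close> on, all primes of \<open>L\<close> belong to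
      \<open>S N\<close>, so membership in \<open>?B N\<close> includes every constraint defining
      \<open>A\<close>.\<close>
    have sub: "prime_factors L \<subseteq> S N"
      using L elim by (auto simp: S_def prime_factors_dvd dest!: dvd_imp_le)
    then have "?B N \<subseteq> A" by (auto simp: smooth_multiples_def A_def)
    then have "infsum (\<lambda>n. if n \<in> ?B N then H n else 0) A = infsum H (?B N)"
      by (intro infsum_cong_neutral) auto
    also have "\<dots> = (\<Prod>p\<in>S N. t p)"
      unfolding t_def using fib[of _ 0] S(2)
      by (intro infsumI has_sum_smooth_multiples[OF H S(1), THEN conjunct2]) auto
    also have "\<dots> = (\<Prod>p\<in>prime_factors L. t p) * (\<Prod>p\<in>S N - prime_factors L. t p)"
      using S sub by (metis mult.commute prod.subset_diff)
    also have "(\<Prod>p\<in>S N - prime_factors L. t p) = (\<Prod>p\<in>S N - prime_factors L. E p)"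
    proof (rule prod.cong[OF refl])
      fix p assume "p \<in> S N - prime_factors L"
      then have p: "prime p" "\<not> p dvd L" using L by (auto simp: S_def prime_factors_dvd)
      show "t p = E p"
        unfolding t_def E_def K[OF p] using p infsum_powers_from_0[OF fib[OF p(1)]] mult_fn_1[OF H]
        by simp
    qed
    also have "\<dots> = (\<Prod>p\<le>N. E p)"
      by (rule prod.mono_neutral_left) (auto simp: S_def E_def prime_factors_dvd)
    finally show ?case .
  qed
  ultimately have "(\<lambda>N. (\<Prod>p\<in>prime_factors L. t p) * (\<Prod>p\<le>N. E p)) \<longlonglongrightarrow> infsum H A"
    by (rule Lim_transform_eventually)
  \<comment> \<open>The partial products are known to tend to \<open>prodinf E\<close> once the
    product converges. The deviation of \<open>E p\<close> from 1 is bounded by the local series of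
    norms, which is summable over the primes.\<close>
  moreover have "summable (\<lambda>p. norm (E p - 1))"
  proof (rule summable_comparison_test')
    let ?T = "\<lambda>p. if prime p then \<Sum>\<^sub>\<infinity>e\<in>{1..}. norm (H (p ^ e)) else 0"
    have "?T summable_on UNIV"
      using prime_power_summable_primes[OF summ]
      by (rule summable_on_cong_neutral[THEN iffD2, rotated -1]) auto
    then show "summable ?T" by (rule summable_on_imp_summable)
    fix p :: nat assume "p \<ge> 0"
    show "norm (norm (E p - 1)) \<le> ?T p"
      using norm_infsum_bound[OF fib[of p 1]] by (auto simp: E_def intro: infsum_nonneg)
  qed
  then have "convergent_prod E"
    by (intro abs_convergent_prod_imp_convergent_prod summable_imp_abs_convergent_prod)
  then have "(\<lambda>N. (\<Prod>p\<in>prime_factors L. t p) * (\<Prod>p\<le>N. E p))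
      \<longlonglongrightarrow> (\<Prod>p\<in>prime_factors L. t p) * prodinf E"
    by (intro tendsto_mult tendsto_const convergent_prod_LIMSEQ)
  ultimately have "infsum H A = (\<Prod>p\<in>prime_factors L. t p) * prodinf E"
    by (rule LIMSEQ_unique)
  then show ?thesis by (simp add: A_def t_def E_def)
qed

subsection \<open>Functions of the greatest common divisor\<close>

lemma mult_fn_prime_factors:
  assumes H: "mult_fn H" and "n > 0"
  shows "H n = (\<Prod>p\<in>prime_factors n. H (p ^ multiplicity p n))"
proof -
  \<comment> \<open>The exponents stay fixed at the valuations of \<open>n\<close> while the set of
    primes varies, which makes induction on \<open>S\<close> possible.\<close>
  have "H (\<Prod>p\<in>S. p ^ multiplicity p n) = (\<Prod>p\<in>S. H (p ^ multiplicity p n))"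
    if "finite S" "\<And>p. p \<in> S \<Longrightarrow> prime p" for S
    using that
  proof (induction S rule: finite_induct)
    case empty
    then show ?case using mult_fn_1[OF H] by simp
  next
    case (insert p S)
    have "coprime (p ^ multiplicity p n) (\<Prod>q\<in>S. q ^ multiplicity q n)"
      using insert by (intro prod_coprime_right coprime_power_left_iff[THEN iffD2] disjI1
          coprime_power_right_iff[THEN iffD2] primes_coprime) auto
    then show ?case
      using insert by (simp add: mult_fn_mult[OF H] prod_pos prime_gt_0_nat)
  qed
  from this[of "prime_factors n"] show ?thesis
    by (intro trans[OF arg_cong[OF prime_factorization_nat[OF assms(2)], of H]]) auto
qed

text \<open>For multiplicative \<open>g\<close> this is the Dirichlet convolution of
  \<open>g\<close> with \<open>moebius_mu\<close>. The encoding by local factors makes it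
  multiplicative by construction.\<close>

definition moebius_transform :: "(nat \<Rightarrow> complex) \<Rightarrow> nat \<Rightarrow> complex" where
  "moebius_transform g n =
     (\<Prod>p\<in>prime_factors n. g (p ^ multiplicity p n) - g (p ^ (multiplicity p n - 1)))"

lemma mult_fn_moebius_transform: "mult_fn (moebius_transform g)"
  unfolding mult_fn_def
proof (intro conjI allI impI)
  fix m n :: nat assume mn: "m > 0" "n > 0" "coprime m n"
  let ?t = "\<lambda>n p. g (p ^ multiplicity p n) - g (p ^ (multiplicity p n - 1))"
  have disj: "prime_factors m \<inter> prime_factors n = {}"
    using mn by (auto simp: prime_factors_dvd dest: coprime_common_divisor)
  have m: "multiplicity p (m * n) = multiplicity p m + multiplicity p n" if "prime p" for p
    using that mn by (intro prime_elem_multiplicity_mult_distrib) auto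
  have 1: "?t (m * n) p = ?t m p" if "p \<in> prime_factors m" for p
  proof -
    have "\<not> p dvd n" "prime p" using that disj mn by (auto simp: prime_factors_dvd)
    then show ?thesis using m[of p] by (simp add: not_dvd_imp_multiplicity_0)
  qed
  have 2: "?t (m * n) p = ?t n p" if "p \<in> prime_factors n" for p
  proof -
    have "\<not> p dvd m" "prime p" using that disj mn by (auto simp: prime_factors_dvd)
    then show ?thesis using m[of p] by (simp add: not_dvd_imp_multiplicity_0)
  qed
  have "moebius_transform g (m * n) = (\<Prod>p\<in>prime_factors m \<union> prime_factors n. ?t (m * n) p)"
    using mn by (simp add: moebius_transform_def prime_factors_product)
  also have "\<dots> = moebius_transform g m * moebius_transform g n"
    using 1 2 disj unfolding moebius_transform_def by (simp add: prod.union_disjoint)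
  finally show "moebius_transform g (m * n) = moebius_transform g m * moebius_transform g n" .
qed (simp add: moebius_transform_def)

lemma moebius_transform_prime_power:
  assumes "prime p" "e > 0"
  shows "moebius_transform g (p ^ e) = g (p ^ e) - g (p ^ (e - 1))"
proof -
  have "prime_factors (p ^ e) = {p}"
    using assms by (simp add: prime_factors_power prime_factorization_prime)
  moreover have "multiplicity p (p ^ e) = e" using assms by simp
  ultimately show ?thesis by (simp add: moebius_transform_def)
qed

text \<open>At each prime the differences telescope to \<open>g (p ^ k)\<close>, starting from the
  value 1 at exponent 0; the product over the primes of \<open>n\<close> rebuilds
  \<open>g n\<close>.\<close>

lemma sum_moebius_transform:
  assumes g: "mult_fn g" and n: "n > 0"
  shows "(\<Sum>d | d dvd n. moebius_transform g d) = g n"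
proof -
  have "(\<Sum>e\<le>k. moebius_transform g (p ^ e)) = g (p ^ k)" if "prime p" for p k
    using mult_fn_1[OF g] mult_fn_1[OF mult_fn_moebius_transform]
    by (induction k) (simp_all add: moebius_transform_prime_power[OF that] del: power_Suc)
  then show ?thesis
    unfolding divisor_sum_mult_fn[OF mult_fn_moebius_transform n] mult_fn_prime_factors[OF assms]
    by (intro prod.cong) auto
qed

section \<open>Frequency of the multiples of a number up to a bound\<close>

definition multiples_freq :: "real \<Rightarrow> nat \<Rightarrow> real" where
  "multiples_freq x d = real (card {n. 1 \<le> n \<and> real n \<le> x \<and> d dvd n}) / x"

lemma finite_nats_upto_real: "finite {n. 1 \<le> n \<and> real n \<le> x}"
  by (rule finite_subset[of _ "{..nat \<lfloor>x\<rfloor>}"]) (auto simp: le_nat_floor)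

lemma multiples_freq_eq:
  assumes "x > 0" "d > 0"
  shows "multiples_freq x d = of_int \<lfloor>x / real d\<rfloor> / x"
proof -
  have "bij_betw (\<lambda>k. d * k) {1..nat \<lfloor>x / real d\<rfloor>} {n. 1 \<le> n \<and> real n \<le> x \<and> d dvd n}"
  proof (rule bij_betwI[where g = "\<lambda>n. n div d"])
    show "(\<lambda>k. d * k) \<in> {1..nat \<lfloor>x / real d\<rfloor>} \<rightarrow> {n. 1 \<le> n \<and> real n \<le> x \<and> d dvd n}"
    proof
      fix k assume k: "k \<in> {1..nat \<lfloor>x / real d\<rfloor>}"
      then have "real k \<le> x / real d" using assms by (simp add: le_nat_iff le_floor_iff)
      then show "d * k \<in> {n. 1 \<le> n \<and> real n \<le> x \<and> d dvd n}"
        using k assms by (simp add: field_simps Suc_le_eq)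
    qed
    show "(\<lambda>n. n div d) \<in> {n. 1 \<le> n \<and> real n \<le> x \<and> d dvd n} \<rightarrow> {1..nat \<lfloor>x / real d\<rfloor>}"
      using assms by (auto simp: field_simps Suc_le_eq elim!: dvdE intro!: le_nat_floor)
  qed (use assms in auto)
  from bij_betw_same_card[OF this]
  have "card {n. 1 \<le> n \<and> real n \<le> x \<and> d dvd n} = nat \<lfloor>x / real d\<rfloor>"
    by simp
  then show ?thesis using assms by (simp add: multiples_freq_def)
qed

lemma multiples_freq_le:
  assumes "x > 0" "d > 0"
  shows "multiples_freq x d \<le> 1 / real d"
proof -
  have "of_int \<lfloor>x / real d\<rfloor> / x \<le> (x / real d) / x"
    using assms by (intro divide_right_mono) auto
  then show ?thesis using assms by (simp add: multiples_freq_eq)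
qed

lemma multiples_freq_nonneg: "x > 0 \<Longrightarrow> multiples_freq x d \<ge> 0"
  by (simp add: multiples_freq_def)

lemma multiples_freq_tendsto:
  assumes d: "d > 0"
  shows "((\<lambda>x. multiples_freq x d) \<longlongrightarrow> 1 / real d) at_top"
proof (rule tendsto_sandwich)
  show "\<forall>\<^sub>F x in at_top. 1 / real d - 1 / x \<le> multiples_freq x d"
    using eventually_gt_at_top[of 0]
  proof eventually_elim
    case (elim x)
    \<comment> \<open>The floor loses at most 1, hence the error \<open>1 / x\<close>.\<close>
    have "(x / real d - 1) / x \<le> of_int \<lfloor>x / real d\<rfloor> / x"
      using elim by (intro divide_right_mono) linarith+
    then show ?case using elim d by (simp add: multiples_freq_eq diff_divide_distrib)
  qed
  show "\<forall>\<^sub>F x in at_top. multiples_freq x d \<le> 1 / real d"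
    using eventually_gt_at_top[of 0] by eventually_elim (use d in \<open>auto intro: multiples_freq_le\<close>)
  have "((\<lambda>x::real. 1 / x) \<longlongrightarrow> 0) at_top"
    by (intro tendsto_divide_0[OF tendsto_const] filterlim_at_top_imp_at_infinity filterlim_ident)
  from tendsto_diff[OF tendsto_const this]
  show "((\<lambda>x. 1 / real d - 1 / x) \<longlongrightarrow> 1 / real d) at_top" by simp
qed simp

section \<open>Double convolution and coefficients for functions of the gcd\<close>

locale gcd_function =
  fixes g :: "nat \<Rightarrow> complex" and f :: "nat \<Rightarrow> nat \<Rightarrow> complex"
  assumes multiplicative: "multiplicative_fn g"
    and summable: "(\<lambda>(p, e). norm (g (p ^ e) - g (p ^ (e - 1))) / real (p ^ (2 * e)))
           summable_on ({p. prime p} \<times> {1..})"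
    and f_gcd: "\<And>n1 n2. n1 > 0 \<Longrightarrow> n2 > 0 \<Longrightarrow> f n1 n2 = g (gcd n1 n2)"
begin

lemma mult_g: "mult_fn g"
  using multiplicative by (simp add: multiplicative_fn_def mult_fn_def)

abbreviation "h \<equiv> moebius_transform g"

text \<open>This is the value of \<open>rf_term\<close> at pairs with
  \<open>m1 * q1 = m2 * q2 = n\<close>.\<close>

definition H :: "nat \<Rightarrow> complex" where
  "H n = h n / of_nat (n ^ 2)"

lemma mult_H: "mult_fn H"
proof -
  have "mult_fn (\<lambda>n. inverse (of_nat (n ^ 2)) :: complex)"
    by (simp add: mult_fn_def power_mult_distrib)
  from mult_fn_times[OF mult_fn_moebius_transform this] show ?thesis
    by (simp add: H_def[abs_def] divide_inverse)
qed

text \<open>Exponent 0 is different: there truncated subtraction makes \<open>local_term\<close> 0,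
  while \<open>H 1 = 1\<close>. Hence the separate summand 1 in \<open>euler_factor\<close>.\<close>

lemma H_prime_power: "prime p \<Longrightarrow> e > 0 \<Longrightarrow> H (p ^ e) = local_term g p e"
  by (simp add: H_def local_term_def moebius_transform_prime_power power_mult mult.commute flip: power_mult)

lemma prime_power_summable_H: "prime_power_summable H"
  unfolding prime_power_summable_def
  by (rule summable_on_cong[THEN iffD1, OF _ summable])
    (auto simp: H_prime_power local_term_def norm_divide norm_power)

lemma f_eq_sum:
  assumes "n1 > 0" "n2 > 0"
  shows "f n1 n2 = (\<Sum>d | d dvd n1 \<and> d dvd n2. h d)"
  using sum_moebius_transform[OF mult_g, of "gcd n1 n2"] assms by (simp add: f_gcd)

text \<open>Writing \<open>f d1 d2\<close> as a sum of \<open>h d\<close> over common divisors makes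
  the double convolution factor for each \<open>d\<close>; the two factors force
  \<open>d = n1\<close> and \<open>d = n2\<close>.\<close>

lemma dirichlet_mu_f:
  assumes "n1 > 0" "n2 > 0"
  shows "dirichlet_mu f n1 n2 = (if n1 = n2 then h n1 else 0)"
proof -
  define u where "u = (\<lambda>d n k. of_bool (d dvd k) * moebius_mu (n div k))"
  have fin: "finite {d. d dvd n1}" "finite {d. d dvd n2}" using assms by auto
  have u: "(\<Sum>k | k dvd n. u d n k) = of_bool (d = n)" if "n > 0" for d n
    using sum_moebius_mu_multiples[OF that, of d] that by (simp add: u_def Collect_conj_eq)
  \<comment> \<open>The range of \<open>d\<close> is enlarged to the divisors of \<open>n1\<close>,
    independent of \<open>d1\<close> and \<open>d2\<close>, so that the sums can be
    exchanged.\<close>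
  have f: "f d1 d2 = (\<Sum>d | d dvd n1. of_bool (d dvd d1 \<and> d dvd d2) * h d)"
    if "d1 dvd n1" "d2 dvd n2" for d1 d2
  proof -
    have "f d1 d2 = (\<Sum>d | d dvd d1 \<and> d dvd d2. h d)"
      using that assms by (intro f_eq_sum) (auto intro: dvd_pos_nat)
    also have "\<dots> = (\<Sum>d\<in>{d. d dvd n1} \<inter> {d. d dvd d1 \<and> d dvd d2}. h d)"
      using that by (intro sum.cong) (auto dest: dvd_trans)
    finally show ?thesis using fin by (simp only: sum_of_bool_mult_eq)
  qed
  have "dirichlet_mu f n1 n2
      = (\<Sum>d1 | d1 dvd n1. \<Sum>d2 | d2 dvd n2. \<Sum>d | d dvd n1. h d * u d n1 d1 * u d n2 d2)"
    unfolding dirichlet_mu_def u_def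
    by (intro sum.cong refl) (simp add: f of_bool_conj sum_distrib_left sum_distrib_right mult_ac del: sum_of_bool_mult_eq)
  also have "\<dots> = (\<Sum>d1 | d1 dvd n1. \<Sum>d | d dvd n1. \<Sum>d2 | d2 dvd n2. h d * u d n1 d1 * u d n2 d2)"
    by (intro sum.cong refl sum.swap)
  also have "\<dots> = (\<Sum>d | d dvd n1. \<Sum>d1 | d1 dvd n1. \<Sum>d2 | d2 dvd n2. h d * u d n1 d1 * u d n2 d2)"
    by (rule sum.swap)
  also have "\<dots> = (\<Sum>d | d dvd n1. h d * (\<Sum>d1 | d1 dvd n1. u d n1 d1) * (\<Sum>d2 | d2 dvd n2. u d n2 d2))"
    unfolding mult.assoc sum_product by (simp only: sum_distrib_left)
  also have "\<dots> = (\<Sum>d | d dvd n1. of_bool (d = n1) * (h d * of_bool (d = n2)))"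
    using u assms by (intro sum.cong) auto
  also have "\<dots> = (\<Sum>d\<in>{d. d dvd n1} \<inter> {d. d = n1}. h d * of_bool (d = n2))"
    using fin(1) by (rule sum_of_bool_mult_eq)
  also have "{d. d dvd n1} \<inter> {d. d = n1} = {n1}" by auto
  finally show ?thesis by simp
qed

lemma abs_summable_H: "(\<lambda>n. norm (H n)) summable_on {1..}"
  by (rule abs_summable_mult_fn[OF mult_H prime_power_summable_H])

lemma summable_H:
  assumes "A \<subseteq> {1..}"
  shows "H summable_on A"
  using abs_summable_summable[OF abs_summable_H] assms by (rule summable_on_subset)

text \<open>The weight is multiplicative and equals 4 at every prime power with positive exponent.
  It absorbs the two factors \<open>2 ^ card (prime_factors n)\<close> coming from a product of two
  Ramanujan sums.\<close>

lemma abs_summable_H_weighted: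
  "(\<lambda>n. 4 ^ card (prime_factors n) * norm (H n)) summable_on {1..}"
proof -
  let ?W = "\<lambda>n. 4 ^ card (prime_factors n) :: complex"
  have "mult_fn ?W"
    unfolding mult_fn_def
  proof (intro conjI allI impI)
    fix m n :: nat assume mn: "m > 0" "n > 0" "coprime m n"
    then have "prime_factors m \<inter> prime_factors n = {}"
      by (auto simp: prime_factors_dvd dest: coprime_common_divisor)
    then show "?W (m * n) = ?W m * ?W n"
      using mn by (simp add: prime_factors_product card_Un_disjoint power_add)
  qed simp
  then have 1: "mult_fn (\<lambda>n. ?W n * H n)" using mult_H by (rule mult_fn_times)
  have "(\<lambda>z. 4 * (case z of (p, e) \<Rightarrow> norm (H (p ^ e)))) summable_on ({p. prime p} \<times> {1..})"
    using prime_power_summable_H unfolding prime_power_summable_def by (rule summable_on_cmult_right)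
  then have "prime_power_summable (\<lambda>n. ?W n * H n)"
    unfolding prime_power_summable_def
    by (rule summable_on_cong[THEN iffD1, rotated])
       (auto simp: norm_mult norm_power prime_factors_power prime_factorization_prime)
  from abs_summable_mult_fn[OF 1 this] show ?thesis by (simp add: norm_mult norm_power)
qed

text \<open>Only pairs with \<open>m1 * q1 = m2 * q2\<close> contribute, and this common value runs
  exactly once through the positive multiples of \<open>lcm q1 q2\<close>.\<close>

lemma has_sum_rf_term:
  assumes q: "q1 > 0" "q2 > 0"
  shows "(rf_term f q1 q2 has_sum infsum H {n. n > 0 \<and> lcm q1 q2 dvd n}) ({1..} \<times> {1..})"
proof -
  let ?B = "{n. n > 0 \<and> lcm q1 q2 dvd n}"
  let ?T = "{m \<in> {1..} \<times> {1..}. fst m * q1 = snd m * q2}"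
  have H: "(H has_sum infsum H ?B) ?B"
    by (intro has_sum_infsum summable_H) auto
  have val: "rf_term f q1 q2 m = (if fst m * q1 = snd m * q2 then H (fst m * q1) else 0)"
    if "m \<in> {1..} \<times> {1..}" for m
  proof -
    obtain x y where m: "m = (x, y)" by (cases m)
    have "x * q1 * y * q2 = (x * q1) ^ 2" if "x * q1 = y * q2"
      using that by (simp add: power2_eq_square mult.assoc)
    then show ?thesis
      using that q by (simp add: m rf_term_def dirichlet_mu_f H_def del: of_nat_mult of_nat_power)
  qed
  have bij: "bij_betw (\<lambda>m. fst m * q1) ?T ?B"
  proof (rule bij_betwI[where g = "\<lambda>n. (n div q1, n div q2)"])
    show "(\<lambda>m. fst m * q1) \<in> ?T \<rightarrow> ?B"
    proof
      fix m assume m: "m \<in> ?T"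
      then have "q2 dvd fst m * q1" by simp
      then have "lcm q1 q2 dvd fst m * q1" by (rule lcm_least[OF dvd_triv_right])
      moreover have "fst m * q1 > 0" using m q by auto
      ultimately show "fst m * q1 \<in> ?B" by blast
    qed
    show "(\<lambda>n. (n div q1, n div q2)) \<in> ?B \<rightarrow> ?T"
      using q by (auto simp: div_greater_zero_iff Suc_le_eq dvd_imp_le)
    fix m assume m: "m \<in> ?T"
    then have "fst m * q1 div q2 = snd m" using q by simp
    then show "(fst m * q1 div q1, fst m * q1 div q2) = m" using q by simp
  qed auto
  have "((\<lambda>m. H (fst m * q1)) has_sum infsum H ?B) ?T"
    using H unfolding has_sum_reindex_bij_betw[OF bij, of H] .
  then show ?thesis
    by (rule has_sum_cong_neutral[THEN iffD1, rotated -1]) (use val in auto)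
qed

lemma rf_coeff_eq:
  "q1 > 0 \<Longrightarrow> q2 > 0 \<Longrightarrow> rf_coeff f q1 q2 = infsum H {n. n > 0 \<and> lcm q1 q2 dvd n}"
  unfolding rf_coeff_def by (rule infsumI[OF has_sum_rf_term])

section \<open>The mean value\<close>

lemma partial_mean_eq:
  assumes "x > 0" "y > 0"
  shows "partial_mean f (x, y)
    = (\<Sum>\<^sub>\<infinity>d\<in>{1..}. h d * of_real (multiples_freq x d * multiples_freq y d))"
proof -
  define X where "X = (\<lambda>x. {n. 1 \<le> n \<and> real n \<le> x})"
  have fin: "finite (X x)" for x unfolding X_def by (rule finite_nats_upto_real)
  have card: "(\<Sum>n\<in>X x. of_bool (d dvd n)) = (of_real (x * multiples_freq x d) :: complex)"
    if "x > 0" for x d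
  proof -
    have "(\<Sum>n\<in>X x. of_bool (d dvd n)) = (of_nat (card (X x \<inter> {n. d dvd n})) :: complex)"
      using sum_of_bool_mult_eq[OF fin[of x], of "\<lambda>n. d dvd n" "\<lambda>_. 1 :: complex"] by simp
    also have "X x \<inter> {n. d dvd n} = {n. 1 \<le> n \<and> real n \<le> x \<and> d dvd n}"
      by (auto simp: X_def)
    finally show ?thesis using that by (simp add: multiples_freq_def)
  qed
  have "(\<Sum>n1\<in>X x. \<Sum>n2\<in>X y. f n1 n2)
      = (\<Sum>n1\<in>X x. \<Sum>n2\<in>X y. \<Sum>d\<in>X x. of_bool (d dvd n1) * of_bool (d dvd n2) * h d)"
  proof (intro sum.cong refl)
    fix n1 n2 assume n: "n1 \<in> X x" "n2 \<in> X y"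
    have "f n1 n2 = (\<Sum>d | d dvd n1 \<and> d dvd n2. h d)"
      using n by (intro f_eq_sum) (auto simp: X_def)
    \<comment> \<open>Every divisor of \<open>n1\<close> is at most \<open>x\<close>, so
      \<open>X x\<close> can serve as a range for \<open>d\<close> that depends on neither
      \<open>n1\<close> nor \<open>n2\<close>.\<close>
    also have "{d. d dvd n1 \<and> d dvd n2} = X x \<inter> {d. d dvd n1 \<and> d dvd n2}"
      using n by (force simp: X_def Suc_le_eq intro: dvd_pos_nat dest: dvd_imp_le)
    finally show "f n1 n2 = (\<Sum>d\<in>X x. of_bool (d dvd n1) * of_bool (d dvd n2) * h d)"
      using sum_of_bool_mult_eq[OF fin[of x], of "\<lambda>d. d dvd n1 \<and> d dvd n2" h] by (simp only: of_bool_conj)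
  qed
  also have "\<dots> = (\<Sum>n1\<in>X x. \<Sum>d\<in>X x. \<Sum>n2\<in>X y. of_bool (d dvd n1) * of_bool (d dvd n2) * h d)"
    by (intro sum.cong refl sum.swap)
  also have "\<dots> = (\<Sum>d\<in>X x. \<Sum>n1\<in>X x. \<Sum>n2\<in>X y. of_bool (d dvd n1) * of_bool (d dvd n2) * h d)"
    by (rule sum.swap)
  also have "\<dots> = (\<Sum>d\<in>X x. (\<Sum>n1\<in>X x. of_bool (d dvd n1)) * (\<Sum>n2\<in>X y. of_bool (d dvd n2)) * h d)"
    unfolding sum_product by (simp only: sum_distrib_right)
  also have "\<dots> = (\<Sum>d\<in>X x. of_real (x * multiples_freq x d) * of_real (y * multiples_freq y d) * h d)"
    by (simp only: card[OF assms(1)] card[OF assms(2)])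
  also have "\<dots> = (\<Sum>d\<in>X x. h d * of_real (multiples_freq x d * multiples_freq y d)) * of_real (x * y)"
    by (simp add: sum_distrib_left sum_distrib_right ac_simps)
  finally have "partial_mean f (x, y) = (\<Sum>d\<in>X x. h d * of_real (multiples_freq x d * multiples_freq y d))"
    using assms by (simp add: partial_mean_def X_def)
  also have "\<dots> = (\<Sum>\<^sub>\<infinity>d\<in>X x. h d * of_real (multiples_freq x d * multiples_freq y d))"
    using fin by simp
  also have "\<dots> = (\<Sum>\<^sub>\<infinity>d\<in>{1..}. h d * of_real (multiples_freq x d * multiples_freq y d))"
  proof (rule infsum_cong_neutral)
    \<comment> \<open>For \<open>d > x\<close> there is no multiple of \<open>d\<close> up to
      \<open>x\<close>, so extending the sum to all \<open>d\<close> only adds zeros.\<close>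
    fix d assume d: "d \<in> {1..} - X x"
    then have "{n. 1 \<le> n \<and> real n \<le> x \<and> d dvd n} = {}"
      by (force simp: X_def dest: dvd_imp_le)
    then have "multiples_freq x d = 0" unfolding multiples_freq_def by (simp only: card.empty)
    then show "h d * of_real (multiples_freq x d * multiples_freq y d) = 0" by simp
  qed (auto simp: X_def)
  finally show ?thesis .
qed

text \<open>Each frequency is at most \<open>1 / d\<close> and tends to \<open>1 / d\<close>, so the
  terms are dominated by \<open>norm (H d)\<close> and tend to \<open>H d\<close>.\<close>

lemma partial_mean_tendsto: "(partial_mean f \<longlongrightarrow> infsum H {1..}) (at_top \<times>\<^sub>F at_top)"
proof -
  let ?F = "\<lambda>z d. h d * of_real (multiples_freq (fst z) d * multiples_freq (snd z) d)"
  have pos: "\<forall>\<^sub>F z in at_top \<times>\<^sub>F at_top. fst z > (0::real) \<and> snd z > (0::real)"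
    by (intro eventually_conj) (auto intro: eventually_compose_filterlim[OF eventually_gt_at_top]
        filterlim_fst filterlim_snd)
  have "((\<lambda>z. infsum (?F z) {1..}) \<longlongrightarrow> infsum H {1..}) (at_top \<times>\<^sub>F at_top)"
  proof (rule tendsto_infsum_dominated[OF abs_summable_H])
    show "\<forall>\<^sub>F z in at_top \<times>\<^sub>F at_top. \<forall>d\<in>{1..}. norm (?F z d) \<le> norm (H d)"
      using pos
    proof eventually_elim
      case (elim z)
      show ?case
      proof
        fix d :: nat assume "d \<in> {1..}"
        then have "multiples_freq (fst z) d * multiples_freq (snd z) d \<le> 1 / real d * (1 / real d)"
          using elim by (intro mult_mono multiples_freq_le multiples_freq_nonneg) auto
        then have "norm (h d) * (multiples_freq (fst z) d * multiples_freq (snd z) d)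
            \<le> norm (h d) * (1 / real d * (1 / real d))"
          by (rule mult_left_mono) simp
        then show "norm (?F z d) \<le> norm (H d)"
          using elim multiples_freq_nonneg[of "fst z" d] multiples_freq_nonneg[of "snd z" d]
          by (simp add: norm_mult H_def norm_divide power2_eq_square abs_mult)
      qed
    qed
  next
    fix d :: nat assume "d \<in> {1..}"
    then have m: "((\<lambda>x. multiples_freq x d) \<longlongrightarrow> 1 / real d) at_top"
      by (intro multiples_freq_tendsto) simp
    have "((\<lambda>z. ?F z d) \<longlongrightarrow> h d * of_real (1 / real d * (1 / real d))) (at_top \<times>\<^sub>F at_top)"
      by (intro tendsto_mult tendsto_const tendsto_of_real
          filterlim_compose[OF m filterlim_fst] filterlim_compose[OF m filterlim_snd])
    then show "((\<lambda>z. ?F z d) \<longlongrightarrow> H d) (at_top \<times>\<^sub>F at_top)"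
      by (simp add: H_def power2_eq_square)
  qed simp
  then show ?thesis
    by (rule Lim_transform_eventually)
       (use pos in \<open>eventually_elim, auto simp: partial_mean_eq\<close>)
qed

text \<open>\<open>Lim\<close> selects this limit because limits along the nontrivial product filter
  are unique.\<close>

lemma mean_value_eq: "mean_value f = infsum H {1..}"
  unfolding mean_value_def
  by (rule tendsto_Lim[OF _ partial_mean_tendsto]) (simp add: prod_filter_eq_bot)

section \<open>Euler products for the coefficients and the mean value\<close>

lemma tail_H:
  assumes "prime p" "k > 0"
  shows "(\<Sum>\<^sub>\<infinity>e\<in>{k..}. H (p ^ e)) = local_tail g p k"
  unfolding local_tail_def using assms by (intro infsum_cong) (auto simp: H_prime_power)

lemma full_H:
  assumes "prime p"
  shows "(\<Sum>\<^sub>\<infinity>e\<in>{0..}. H (p ^ e)) = euler_factor g p"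
  using infsum_powers_from_0[OF prime_power_summable_fiber[OF prime_power_summable_H assms]]
    tail_H[OF assms, of 1] mult_fn_1[OF mult_H] by (simp add: euler_factor_def)

lemma euler_factors_eq:
  "(\<Prod>p. if prime p \<and> \<not> p dvd L then 1 + (\<Sum>\<^sub>\<infinity>e\<in>{1..}. H (p ^ e)) else 1)
    = (\<Prod>p. if prime p \<and> \<not> p dvd L then euler_factor g p else 1)"
  by (rule arg_cong[of _ _ prodinf]) (auto simp: fun_eq_iff euler_factor_def tail_H)

text \<open>Divisibility by \<open>L\<close> means lower bounds on the valuations at the primes of
  \<open>L\<close>, which is the Euler product with \<open>K\<close> the valuation of
  \<open>L\<close>. These bounds are positive, so the local series never reach exponent 0.\<close>

lemma infsum_H_multiples:
  assumes L: "L > 0"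
  shows "infsum H {n. n > 0 \<and> L dvd n} = (\<Prod>p\<in>prime_factors L. local_tail g p (multiplicity p L)) *
    (\<Prod>p. if prime p \<and> \<not> p dvd L then euler_factor g p else 1)"
proof -
  have "{n. n > 0 \<and> L dvd n} = {n. n > 0 \<and> (\<forall>p\<in>prime_factors L. multiplicity p L \<le> multiplicity p n)}"
  proof (intro Collect_cong conj_cong refl)
    fix n :: nat assume n: "n > 0"
    have "L dvd n" if *: "\<forall>p\<in>prime_factors L. multiplicity p L \<le> multiplicity p n"
    proof (rule multiplicity_le_imp_dvd)
      fix p :: nat assume "prime p"
      then show "multiplicity p L \<le> multiplicity p n"
        using * by (cases "multiplicity p L = 0") (auto simp: prime_factors_multiplicity)
    qed (use L in simp)
    then show "L dvd n \<longleftrightarrow> (\<forall>p\<in>prime_factors L. multiplicity p L \<le> multiplicity p n)"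
      using n by (auto intro: dvd_imp_multiplicity_le)
  qed
  moreover have "(\<Prod>p\<in>prime_factors L. \<Sum>\<^sub>\<infinity>e\<in>{multiplicity p L..}. H (p ^ e))
      = (\<Prod>p\<in>prime_factors L. local_tail g p (multiplicity p L))"
    by (intro prod.cong refl tail_H) (auto simp: prime_factors_multiplicity)
  ultimately show ?thesis
    using euler_product[OF mult_H prime_power_summable_H L, of "\<lambda>p. multiplicity p L"]
    by (simp add: not_dvd_imp_multiplicity_0 euler_factors_eq)
qed

text \<open>The same Euler product with \<open>K = 0\<close>. Separating the primes of
  \<open>L\<close> here too makes the infinite product identical to the one for multiples of
  \<open>L\<close>, so comparing the sums involves finite products only.\<close>

lemma infsum_H_split:
  assumes L: "L > 0"
  shows "infsum H {1..} = (\<Prod>p\<in>prime_factors L. euler_factor g p) *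
    (\<Prod>p. if prime p \<and> \<not> p dvd L then euler_factor g p else 1)"
proof -
  have "{1::nat..} = {n. n > 0}" by auto
  moreover have "(\<Prod>p\<in>prime_factors L. \<Sum>\<^sub>\<infinity>e\<in>{0..}. H (p ^ e)) = (\<Prod>p\<in>prime_factors L. euler_factor g p)"
    by (intro prod.cong refl full_H) auto
  ultimately show ?thesis
    using euler_product[OF mult_H prime_power_summable_H L, of "\<lambda>_. 0"]
    by (simp add: euler_factors_eq)
qed

section \<open>The Ramanujan-Fourier expansion\<close>

lemma has_sum_ramanujan_expansion:
  assumes n: "n1 > 0" "n2 > 0"
  shows "((\<lambda>(q1, q2). rf_coeff f q1 q2 * ramanujan_sum q1 n1 * ramanujan_sum q2 n2)
            has_sum f n1 n2) ({1..} \<times> {1..})"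
proof -
  define D where "D = (\<lambda>n::nat. {q. q dvd n} \<times> {q. q dvd n})"
  define c where "c = (\<lambda>(q1, q2). ramanujan_sum q1 n1 * ramanujan_sum q2 n2)"
  \<comment> \<open>The part of the two Ramanujan sum bounds that does not depend on
    \<open>n\<close>.\<close>
  define C where "C = (\<Sum>d | d dvd n1. real d) * (\<Sum>d | d dvd n2. real d)"
  define F where "F = (\<lambda>(n, q). H n * c q)"
  have finD: "finite (D n)" if "n > 0" for n using that by (simp add: D_def)
  have sumD: "(\<Sum>q\<in>D n. \<phi> (fst q) * \<psi> (snd q)) = (\<Sum>q | q dvd n. \<phi> q) * (\<Sum>q | q dvd n. \<psi> q)"
    for n and \<phi> \<psi> :: "nat \<Rightarrow> 'a::comm_semiring_1"
    unfolding D_def by (simp add: sum_product sum.cartesian_product case_prod_unfold)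
  have bound: "(\<Sum>q\<in>D n. norm (H n * c q)) \<le> C * (4 ^ card (prime_factors n) * norm (H n))" if "n > 0" for n
  proof -
    let ?S = "\<lambda>m. \<Sum>q | q dvd n. norm (ramanujan_sum q m)"
    have "(\<Sum>q\<in>D n. norm (H n * c q))
        = norm (H n) * (\<Sum>q\<in>D n. norm (ramanujan_sum (fst q) n1) * norm (ramanujan_sum (snd q) n2))"
      by (simp add: norm_mult c_def case_prod_unfold sum_distrib_left)
    also have "\<dots> = norm (H n) * (?S n1 * ?S n2)"
      using sumD[of "\<lambda>q. norm (ramanujan_sum q n1)" "\<lambda>q. norm (ramanujan_sum q n2)" n] by simp
    also have "\<dots> \<le> norm (H n) * (((\<Sum>d | d dvd n1. real d) * 2 ^ card (prime_factors n)) *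
        ((\<Sum>d | d dvd n2. real d) * 2 ^ card (prime_factors n)))"
      using that n by (intro mult_left_mono mult_mono sum_norm_ramanujan_sum_divisors)
        (auto intro!: mult_nonneg_nonneg sum_nonneg)
    also have "\<dots> = C * (4 ^ card (prime_factors n) * norm (H n))"
      by (simp add: C_def ac_simps flip: power_mult_distrib)
    finally show ?thesis .
  qed
  \<comment> \<open>If \<open>n\<close> divides both arguments, the two divisor sums give
    \<open>n * n\<close>, which cancels the denominator of \<open>H n\<close>; otherwise one of them
    is 0.\<close>
  have inner: "(\<Sum>q\<in>D n. H n * c q) = of_bool (n dvd n1 \<and> n dvd n2) * h n" if "n > 0" for n
  proof -
    have "(\<Sum>q\<in>D n. H n * c q) = H n * (\<Sum>q\<in>D n. ramanujan_sum (fst q) n1 * ramanujan_sum (snd q) n2)"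
      by (simp add: c_def case_prod_unfold sum_distrib_left)
    also have "\<dots> = of_bool (n dvd n1 \<and> n dvd n2) * h n"
      using sumD[of "\<lambda>q. ramanujan_sum q n1" "\<lambda>q. ramanujan_sum q n2" n] that
      by (auto simp: sum_ramanujan_sum_divisors H_def power2_eq_square)
    finally show ?thesis .
  qed
  have "(\<lambda>n. \<Sum>q\<in>D n. norm (H n * c q)) summable_on {1..}"
    using summable_on_cmult_right[OF abs_summable_H_weighted, of C]
    by (rule summable_on_comparison_test) (auto intro: bound sum_nonneg)
  \<comment> \<open>Each \<open>D n\<close> is finite, so absolute summability over the triples
    reduces to that of the finite inner sums of norms.\<close>
  then have "(\<lambda>z. norm (F z)) summable_on Sigma {1..} D"
    by (rule summable_on_SigmaI[rotated]) (auto simp: F_def finD)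
  then have summF: "F summable_on Sigma {1..} D"
    by (rule abs_summable_summable)
  have "((\<lambda>n. of_bool (n dvd n1 \<and> n dvd n2) * h n) has_sum f n1 n2) {1..}"
  proof (rule has_sum_finite_neutralI[of "{d. d dvd n1 \<and> d dvd n2}"])
    show "f n1 n2 = (\<Sum>n | n dvd n1 \<and> n dvd n2. of_bool (n dvd n1 \<and> n dvd n2) * h n)"
      unfolding f_eq_sum[OF n] by (intro sum.cong) auto
  qed (use n in \<open>auto simp: Suc_le_eq intro!: gr0I\<close>)
  then have sumF: "(F has_sum f n1 n2) (Sigma {1..} D)"
  proof (rule has_sum_SigmaI[rotated])
    fix n :: nat assume "n \<in> {1..}"
    then show "((\<lambda>q. F (n, q)) has_sum of_bool (n dvd n1 \<and> n dvd n2) * h n) (D n)"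
      using finD[of n] inner[of n] by (intro has_sum_finiteI) (auto simp: F_def)
  qed (rule summF)
  \<comment> \<open>The same triples seen from \<open>q\<close>: the fibre consists of the common
    multiples of both entries, so summing \<open>H\<close> over it gives the coefficient.\<close>
  define E where "E = (\<lambda>q. {n. n > 0 \<and> fst q dvd n \<and> snd q dvd (n::nat)})"
  have bij: "bij_betw prod.swap (Sigma ({1..} \<times> {1..}) E) (Sigma {1..} D)"
    by (rule bij_betwI[where g = prod.swap]) (auto simp: D_def E_def Suc_le_eq intro!: gr0I)
  have "((\<lambda>z. F (prod.swap z)) has_sum f n1 n2) (Sigma ({1..} \<times> {1..}) E)"
    using sumF unfolding has_sum_reindex_bij_betw[OF bij, of F] .
  then have "((\<lambda>q. rf_coeff f (fst q) (snd q) * c q) has_sum f n1 n2) ({1..} \<times> {1..})"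
  proof (rule has_sum_SigmaD)
    fix q :: "nat \<times> nat" assume q: "q \<in> {1..} \<times> {1..}"
    have q0: "fst q > 0" "snd q > 0" using q by auto
    have "infsum H (E q) = rf_coeff f (fst q) (snd q)"
      unfolding rf_coeff_eq[OF q0] E_def lcm_least_iff ..
    moreover have "(H has_sum infsum H (E q)) (E q)"
      by (rule has_sum_infsum[OF summable_H]) (auto simp: E_def)
    ultimately have "(H has_sum rf_coeff f (fst q) (snd q)) (E q)" by simp
    then show "((\<lambda>n. F (prod.swap (q, n))) has_sum rf_coeff f (fst q) (snd q) * c q) (E q)"
      unfolding F_def by (simp add: has_sum_cmult_left)
  qed
  then show ?thesis by (simp add: c_def case_prod_unfold mult.assoc)
qed

text \<open>The division-free form of the coefficient formula, which stays meaningful when an Euler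
  factor vanishes.\<close>

lemma rf_coeff_euler_product:
  assumes q: "q1 > 0" "q2 > 0"
  shows "rf_coeff f q1 q2 =
    (\<Prod>p \<in> prime_factors (lcm q1 q2).
       local_tail g p (max (multiplicity p q1) (multiplicity p q2))) *
    (\<Prod>p. if prime p \<and> \<not> p dvd lcm q1 q2 then euler_factor g p else 1)"
proof -
  have "multiplicity p (lcm q1 q2) = max (multiplicity p q1) (multiplicity p q2)"
    if "p \<in> prime_factors (lcm q1 q2)" for p
    using that q by (intro multiplicity_lcm) auto
  then show ?thesis
    using q infsum_H_multiples[of "lcm q1 q2"] by (simp add: rf_coeff_eq lcm_pos_nat)
qed

text \<open>Coefficient and mean value share the infinite product over primes not dividing
  \<open>lcm q1 q2\<close>; they differ only in the finitely many factors at the remaining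
  primes.\<close>

lemma rf_coeff_mean_value:
  assumes q: "q1 > 0" "q2 > 0"
    and nz: "\<forall>p \<in> prime_factors (lcm q1 q2). euler_factor g p \<noteq> 0"
  shows "rf_coeff f q1 q2 = mean_value f *
    (\<Prod>p \<in> prime_factors (lcm q1 q2).
       local_tail g p (max (multiplicity p q1) (multiplicity p q2)) / euler_factor g p)"
proof -
  have "(\<Prod>p \<in> prime_factors (lcm q1 q2). euler_factor g p) \<noteq> 0"
    using nz by simp
  then show ?thesis
    unfolding rf_coeff_euler_product[OF q] mean_value_eq infsum_H_split[OF lcm_pos_nat[OF q]]
      prod_dividef by (simp add: field_simps)
qed

end

theorem theorem3p5:
  fixes g :: "nat \<Rightarrow> complex" and f :: "nat \<Rightarrow> nat \<Rightarrow> complex"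
  assumes "multiplicative_fn g"
    and "(\<lambda>(p, e). norm (g (p ^ e) - g (p ^ (e - 1))) / real (p ^ (2 * e)))
           summable_on ({p. prime p} \<times> {1..})"
    and "\<And>n1 n2. n1 > 0 \<Longrightarrow> n2 > 0 \<Longrightarrow> f n1 n2 = g (gcd n1 n2)"
  shows "(partial_mean f \<longlongrightarrow> mean_value f) (at_top \<times>\<^sub>F at_top)
    \<and> (\<forall>q1>0. \<forall>q2>0. rf_term f q1 q2 summable_on ({1..} \<times> {1..}))
    \<and> (\<forall>n1>0. \<forall>n2>0.
         ((\<lambda>(q1, q2). rf_coeff f q1 q2 * ramanujan_sum q1 n1 * ramanujan_sum q2 n2)
            has_sum f n1 n2) ({1..} \<times> {1..}))
    \<and> rf_coeff f 1 1 = mean_value f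
    \<and> (\<forall>q1>0. \<forall>q2>0. lcm q1 q2 > 1 \<longrightarrow>
         (\<forall>p \<in> prime_factors (lcm q1 q2). euler_factor g p \<noteq> 0) \<longrightarrow>
         rf_coeff f q1 q2 = mean_value f *
           (\<Prod>p \<in> prime_factors (lcm q1 q2).
              local_tail g p (max (multiplicity p q1) (multiplicity p q2)) / euler_factor g p))
    \<and> (\<forall>q1>0. \<forall>q2>0. lcm q1 q2 > 1 \<longrightarrow>
         rf_coeff f q1 q2 =
           (\<Prod>p \<in> prime_factors (lcm q1 q2).
              local_tail g p (max (multiplicity p q1) (multiplicity p q2))) *
           (\<Prod>p. if prime p \<and> \<not> p dvd lcm q1 q2 then euler_factor g p else 1))"
proof -
  interpret gcd_function g f by unfold_locales fact+
  \<comment> \<open>For \<open>q1 = q2 = 1\<close> the multiples are all positive integers, so the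
    coefficient is the same sum of \<open>H\<close> as the mean value.\<close>
  have "{n::nat. n > 0 \<and> lcm 1 1 dvd n} = {1..}" by auto
  then have A: "rf_coeff f 1 1 = mean_value f"
    using rf_coeff_eq[of 1 1] mean_value_eq by simp
  have B: "rf_term f q1 q2 summable_on ({1..} \<times> {1..})" if "q1 > 0" "q2 > 0" for q1 q2
    using has_sum_rf_term[OF that] by (rule has_sum_imp_summable)
  have C: "(partial_mean f \<longlongrightarrow> mean_value f) (at_top \<times>\<^sub>F at_top)"
    using partial_mean_tendsto by (simp only: mean_value_eq)
  show ?thesis
    by (intro conjI allI impI;
        rule A B C has_sum_ramanujan_expansion rf_coeff_mean_value rf_coeff_euler_product; assumption?)
qed

end
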